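(* Let $m \geq 2$ be an integer and consider the sequence $$A_m(n) = \frac{\left(\tfrac{1}{m}\right)_n \left(1 - \tfrac{1}{m}\right)_n}{n!^2}, \quad n \geq 0.$$ (a) $A_m(n)$ is a diagonal for all $m \geq 2$. (b) $A_m(n)$ is a constant term if and only if $m \in \{2, 3, 4, 6\}$.
   Context: $(x)_n = x(x+1)\cdots(x+n-1)$ denotes the rising factorial (with $(x)_0 = 1$). Diagonal: a sequence $(A(n))_{n \geq 0}$ of rational numbers is a diagonal if for some $d \geq 1$ there is a rational function $R(x_1,\ldots,x_d)$ with rational coefficients having a power series expansion $R = \sum_{n_1,\ldots,n_d \geq 0} c(n_1,\ldots,n_d) x_1^{n_1} \cdots x_d^{n_d}$ at the origin such that $A(n) = c(n,n,\ldots,n)$ for all $n \geq 0$. Constant term: for a Laurent polynomial $F \in \mathbb{Q}[\boldsymbol{x}^{\pm 1}] = \mathbb{Q}[x_1^{\pm 1}, \ldots, x_d^{\pm 1}]$, $\operatorname{ct}[F]$ denotes its constant coefficient. A sequence $(A(n))_{n \geq 0}$ is a constant term if there exist $d$ and $P, Q \in \mathbb{Q}[x_1^{\pm 1}, \ldots, x_d^{\pm 1}]$ such that $A(n) = \operatorname{ct}[P(\boldsymbol{x})^n Q(\boldsymbol{x})]$ for all $n \geq 0$. *)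

theory Defs
  imports Complex_Main "HOL-Library.Poly_Mapping"
begin

text \<open>
  An exponent vector maps variable indices to exponents (finitely many of them nonzero); the
  variables \<open>x\<^sub>1, \<dots>, x\<^sub>d\<close> have the indices \<open>0, \<dots>, d - 1\<close>.  The product of the types \<open>mpoly_rat\<close>
  and \<open>laurent_rat\<close> is the convolution provided by \<^theory>\<open>HOL-Library.Poly_Mapping\<close>.
\<close>

type_synonym mpoly_rat = "(nat \<Rightarrow>\<^sub>0 nat) \<Rightarrow>\<^sub>0 rat"
type_synonym laurent_rat = "(nat \<Rightarrow>\<^sub>0 int) \<Rightarrow>\<^sub>0 rat"
type_synonym mseries_rat = "(nat \<Rightarrow>\<^sub>0 nat) \<Rightarrow> rat"

definition in_vars :: "nat \<Rightarrow> ((nat \<Rightarrow>\<^sub>0 'e::zero) \<Rightarrow>\<^sub>0 rat) \<Rightarrow> bool" where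
  "in_vars d p \<longleftrightarrow> (\<forall>e \<in> Poly_Mapping.keys p. Poly_Mapping.keys e \<subseteq> {..<d})"

definition series_in_vars :: "nat \<Rightarrow> mseries_rat \<Rightarrow> bool" where
  "series_in_vars d c \<longleftrightarrow> (\<forall>e. c e \<noteq> 0 \<longrightarrow> Poly_Mapping.keys e \<subseteq> {..<d})"

text \<open>Cauchy product; the index set of each coefficient is finite (see \<open>finite_add_splits\<close>).\<close>

definition series_mult :: "mseries_rat \<Rightarrow> mseries_rat \<Rightarrow> mseries_rat" where
  "series_mult f g = (\<lambda>e. \<Sum>(a, b) | a + b = e. f a * g b)"

text \<open>
  The series \<open>c\<close> is the expansion at the origin of the rational function \<open>num / den\<close>: the identity
  \<open>c = num / den\<close> holds in the fraction field of the ring of formal power series.  As that ring is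
  an integral domain, \<open>c\<close> is determined by the fraction \<open>num / den\<close>.
\<close>

definition expansion_of_quotient ::
    "nat \<Rightarrow> mpoly_rat \<Rightarrow> mpoly_rat \<Rightarrow> mseries_rat \<Rightarrow> bool" where
  "expansion_of_quotient d num den c \<longleftrightarrow>
     in_vars d num \<and> in_vars d den \<and> den \<noteq> 0 \<and> series_in_vars d c \<and>
     series_mult (Poly_Mapping.lookup den) c = Poly_Mapping.lookup num"

definition diag_exponent :: "nat \<Rightarrow> nat \<Rightarrow> (nat \<Rightarrow>\<^sub>0 nat)" where
  "diag_exponent d n = (\<Sum>i<d. Poly_Mapping.single i n)"

definition is_diagonal :: "(nat \<Rightarrow> rat) \<Rightarrow> bool" where
  "is_diagonal A \<longleftrightarrow>
     (\<exists>d\<ge>1. \<exists>num den c. expansion_of_quotient d num den c \<and>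
        (\<forall>n. A n = c (diag_exponent d n)))"

definition ct :: "laurent_rat \<Rightarrow> rat" where
  "ct F = Poly_Mapping.lookup F 0"

definition is_constant_term :: "(nat \<Rightarrow> rat) \<Rightarrow> bool" where
  "is_constant_term A \<longleftrightarrow>
     (\<exists>d. \<exists>P Q :: laurent_rat. in_vars d P \<and> in_vars d Q \<and> (\<forall>n. A n = ct (P ^ n * Q)))"

definition hyp_seq :: "nat \<Rightarrow> nat \<Rightarrow> rat" where
  "hyp_seq m n =
     pochhammer (1 / of_nat m) n * pochhammer (1 - 1 / of_nat m) n / (fact n)\<^sup>2"

lemma finite_add_splits: "finite {(a, b). a + b = (e :: nat \<Rightarrow>\<^sub>0 nat)}"
proof -
  let ?K = "Poly_Mapping.keys e"
  let ?M = "Max (insert 0 (Poly_Mapping.lookup e ` ?K))"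
  let ?S = "{f. \<forall>i. (i \<in> ?K \<longrightarrow> f i \<in> {..?M}) \<and> (i \<notin> ?K \<longrightarrow> f i = (0::nat))}"
  have fin: "finite ?S"
    by (rule finite_set_of_finite_funs) auto
  have le: "Poly_Mapping.lookup a \<in> ?S" if "a + b = e \<or> b + a = e" for a b
  proof -
    have *: "Poly_Mapping.lookup a i \<le> Poly_Mapping.lookup e i" for i
      using that by (auto simp: lookup_add)
    have "Poly_Mapping.lookup a i \<le> ?M" if "i \<in> ?K" for i
      using that by (intro order_trans [OF * Max_ge]) auto
    moreover have "Poly_Mapping.lookup a i = 0" if "i \<notin> ?K" for i
      using * [of i] that by (simp add: in_keys_iff)
    ultimately show ?thesis by blast
  qed
  have "finite (Poly_Mapping.lookup -` ?S)"
    by (rule finite_vimageI [OF fin]) (auto intro: injI simp: Poly_Mapping.lookup_inject)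
  moreover have "{(a, b). a + b = e} \<subseteq> Poly_Mapping.lookup -` ?S \<times> Poly_Mapping.lookup -` ?S"
    using le by blast
  ultimately show ?thesis
    by (meson finite_SigmaI finite_subset)
qed

lemma lookup_diag_exponent: "Poly_Mapping.lookup (diag_exponent d n) i = (if i < d then n else 0)"
proof -
  have "Poly_Mapping.lookup (diag_exponent d n) i = (\<Sum>j<d. if j = i then n else 0)"
    by (simp add: diag_exponent_def lookup_sum lookup_single when_def)
  then show ?thesis by simp
qed

lemma series_mult_lookup:
  "series_mult (Poly_Mapping.lookup p) (Poly_Mapping.lookup q) =
     Poly_Mapping.lookup (p * q)"
proof
  fix e
  let ?g = "\<lambda>(a, b). Poly_Mapping.lookup p a * Poly_Mapping.lookup q b when e = a + b"
  have "Poly_Mapping.lookup (p * q) e = (\<Sum>x. ?g x)"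
    by (simp add: times_poly_mapping.rep_eq prod_fun_unfold_prod)
  also have "\<dots> = sum ?g {(a, b). a + b = e}"
    by (rule Sum_any.expand_superset [OF finite_add_splits]) auto
  also have "\<dots> = (\<Sum>(a, b) | a + b = e. Poly_Mapping.lookup p a * Poly_Mapping.lookup q b)"
    by (rule sum.cong) auto
  finally show "series_mult (Poly_Mapping.lookup p) (Poly_Mapping.lookup q) e = Poly_Mapping.lookup (p * q) e"
    by (simp add: series_mult_def)
qed

end

theory Submission
  imports Defs "HOL-Computational_Algebra.Computational_Algebra" "HOL-Number_Theory.Cong"
begin

text \<open>
  Write \<open>u(y) = (1 - (1 - y)\<^sup>m) / y\<close>, a polynomial with constant coefficient \<open>m\<close>.

  \<^emph>\<open>Diagonal.\<close>  Substituting \<open>x = 1 - (1 - y)\<^sup>m = y u(y)\<close> in the residue that extracts the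
  coefficient of \<open>x\<^sup>n\<close> turns the algebraic functions \<open>(1 - x)\<close> to the power \<open>-1/m\<close> and
  \<open>-1 + 1/m\<close> into rational ones: the coefficients \<open>(1/m)\<^sub>n / n!\<close> and \<open>(1 - 1/m)\<^sub>n / n!\<close> are those of
  \<open>y\<^sup>n\<close> in \<open>m (1 - y)\<close> to the power \<open>m - 2\<close> divided by \<open>u(y)\<close> to the power \<open>n + 1\<close>, and in \<open>m\<close>
  divided by \<open>u(y)\<close> to the power \<open>n + 1\<close>.  Multiplying the first (in \<open>y\<close>), the second (in \<open>z\<close>) and
  \<open>t\<^sup>n\<close>, and summing the geometric series, exhibits the sequence as the diagonal of a rational
  function in \<open>t, y, z\<close> with denominator \<open>u(y) u(z) - t\<close>
  (\<open>inverse_power_nth_eq_pochhammer\<close>, \<open>expansion_three_variables\<close>).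

  \<^emph>\<open>Constant term for \<open>m = 2, 3, 4, 6\<close>.\<close>  In these cases the sequence is a product of two binomial
  coefficients and a geometric progression, and each factor is a constant term in its own variable
  (\<open>is_constant_term_binomial_product\<close>).

  \<^emph>\<open>No other constant terms.\<close>  For a large prime \<open>p\<close>, raising a Laurent polynomial to the \<open>p\<close>-th power
  acts modulo \<open>p\<close> as the substitution of \<open>p\<close>-th powers for the variables, so that a constant
  term sequence \<open>A\<close> satisfies \<open>A(p) = ct P ct Q = A(p\<^sup>2)\<close> modulo \<open>p\<close>
  (\<open>ct_prime_power_cong\<close>).  On the other hand, Dwork's congruence evaluates both sides for the
  hypergeometric sequence: with \<open>p k = 1\<close> and \<open>p l = k\<close> modulo \<open>m\<close>, where \<open>0 < k, l < m\<close>, they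
  are \<open>k (m - k) / m\<^sup>2\<close> and \<open>l (m - l) / m\<^sup>2\<close>.  If \<open>p > m\<^sup>2\<close>, these can only be congruent when
  \<open>l = k\<close> or \<open>l = m - k\<close>, which means \<open>p = 1\<close> or \<open>p = -1\<close> modulo \<open>m\<close>
  (\<open>hyp_seq_not_prime_square_cong\<close>).  Comparing \<open>p\<close> with \<open>p\<^sup>2\<close> has the advantage that one large
  prime outside these two classes suffices; such a prime exists as soon as \<open>m\<close> has more than two
  reduced residue classes, by a variant of Euclid's argument (\<open>ex_large_prime_not_cong_pm1\<close>), and
  Dirichlet's theorem is avoided.
\<close>

section \<open>Expansion of a rational function in three variables\<close>

lemma in_vars_iff_lookup:
  "in_vars d p \<longleftrightarrow> (\<forall>e. Poly_Mapping.lookup p e \<noteq> 0 \<longrightarrow> Poly_Mapping.keys e \<subseteq> {..<d})"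
  by (auto simp: in_vars_def in_keys_iff)

lemma in_vars_single: "Poly_Mapping.keys e \<subseteq> {..<d} \<Longrightarrow> in_vars d (Poly_Mapping.single e k)"
  by (simp add: in_vars_def)

lemma in_vars_diff: "in_vars d p \<Longrightarrow> in_vars d q \<Longrightarrow> in_vars d (p - q)"
  unfolding in_vars_iff_lookup lookup_minus by (metis diff_zero)

lemma in_vars_sum: "(\<And>i. i \<in> A \<Longrightarrow> in_vars d (f i)) \<Longrightarrow> in_vars d (sum f A)"
  unfolding in_vars_iff_lookup lookup_sum
  by (meson sum.not_neutral_contains_not_neutral)

lemma series_mult_sum:
  "series_mult (Poly_Mapping.lookup (sum f A)) c e =
     (\<Sum>i\<in>A. series_mult (Poly_Mapping.lookup (f i)) c e)"
  unfolding series_mult_def lookup_sum sum_distrib_right case_prod_unfold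
  by (rule sum.swap)

lemma series_mult_diff:
  "series_mult (Poly_Mapping.lookup (p - q)) c e =
     series_mult (Poly_Mapping.lookup p) c e - series_mult (Poly_Mapping.lookup q) c e"
  by (simp add: series_mult_def lookup_minus left_diff_distrib sum_subtractf case_prod_unfold)

lemma series_mult_single_add:
  "series_mult (Poly_Mapping.lookup (Poly_Mapping.single a k)) c (a + b) = k * c b"
proof -
  have "(\<Sum>(a', b') | a' + b' = a + b. Poly_Mapping.lookup (Poly_Mapping.single a k) a' * c b') =
        (\<Sum>(a', b')\<in>{(a, b)}. Poly_Mapping.lookup (Poly_Mapping.single a k) a' * c b')"
    by (rule sum.mono_neutral_right [OF finite_add_splits])
      (auto simp: lookup_single when_def split: if_splits)
  then show ?thesis
    by (simp add: series_mult_def)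
qed

lemma series_mult_single_eq_0:
  assumes "\<And>b. a + b \<noteq> e"
  shows "series_mult (Poly_Mapping.lookup (Poly_Mapping.single a k)) c e = 0"
  unfolding series_mult_def
  by (rule sum.neutral) (use assms in \<open>auto simp: lookup_single when_def\<close>)

lemma series_in_vars_mult:
  assumes "in_vars d p" "series_in_vars d c"
  shows "series_in_vars d (series_mult (Poly_Mapping.lookup p) c)"
  unfolding series_in_vars_def
proof (intro allI impI)
  fix e assume "series_mult (Poly_Mapping.lookup p) c e \<noteq> 0"
  then obtain a b where "a + b = e" "Poly_Mapping.lookup p a \<noteq> 0" "c b \<noteq> 0"
    unfolding series_mult_def by (elim sum.not_neutral_contains_not_neutral) auto
  then show "Poly_Mapping.keys e \<subseteq> {..<d}"
    using assms Poly_Mapping.keys_add [of a b]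
    unfolding in_vars_iff_lookup series_in_vars_def by blast
qed

definition exponent3 :: "nat \<Rightarrow> nat \<Rightarrow> nat \<Rightarrow> (nat \<Rightarrow>\<^sub>0 nat)" where
  "exponent3 n i j =
     Poly_Mapping.single 0 n + Poly_Mapping.single 1 i + Poly_Mapping.single 2 j"

lemma lookup_exponent3:
  "Poly_Mapping.lookup (exponent3 n i j) v =
     (if v = 0 then n else if v = 1 then i else if v = 2 then j else 0)"
  by (auto simp: exponent3_def lookup_add lookup_single when_def)

lemma exponent3_eq_iff: "exponent3 n i j = exponent3 n' i' j' \<longleftrightarrow> n = n' \<and> i = i' \<and> j = j'"
proof
  assume "exponent3 n i j = exponent3 n' i' j'"
  then have "Poly_Mapping.lookup (exponent3 n i j) v = Poly_Mapping.lookup (exponent3 n' i' j') v" for v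
    by simp
  from this [of 0] this [of 1] this [of 2] show "n = n' \<and> i = i' \<and> j = j'"
    by (simp add: lookup_exponent3)
qed simp

lemma exponent3_add:
  "exponent3 n i j + exponent3 n' i' j' = exponent3 (n + n') (i + i') (j + j')"
  by (simp add: exponent3_def single_add algebra_simps)

lemma keys_exponent3: "Poly_Mapping.keys (exponent3 n i j) \<subseteq> {..<3}"
  by (auto simp: in_keys_iff lookup_exponent3 split: if_splits)

lemma exponent3_lookup:
  assumes "Poly_Mapping.keys e \<subseteq> {..<3}"
  shows "e = exponent3 (Poly_Mapping.lookup e 0) (Poly_Mapping.lookup e 1) (Poly_Mapping.lookup e 2)"
proof (rule poly_mapping_eqI)
  fix v
  have "Poly_Mapping.lookup e v = 0" if "\<not> v < 3"
    using assms that by (auto simp: in_keys_iff)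
  moreover have "v = 0 \<or> v = 1 \<or> v = 2" if "v < 3"
    using that by auto
  ultimately show "Poly_Mapping.lookup e v = Poly_Mapping.lookup
      (exponent3 (Poly_Mapping.lookup e 0) (Poly_Mapping.lookup e 1) (Poly_Mapping.lookup e 2)) v"
    by (cases "v < 3") (auto simp: lookup_exponent3)
qed

lemma series_mult_single_exponent3:
  "series_mult (Poly_Mapping.lookup (Poly_Mapping.single (exponent3 n i j) k)) c (exponent3 n' i' j') =
     (if n \<le> n' \<and> i \<le> i' \<and> j \<le> j' then k * c (exponent3 (n' - n) (i' - i) (j' - j)) else 0)"
proof (cases "n \<le> n' \<and> i \<le> i' \<and> j \<le> j'")
  case True
  then have "exponent3 n' i' j' = exponent3 n i j + exponent3 (n' - n) (i' - i) (j' - j)"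
    by (simp add: exponent3_add)
  then show ?thesis
    using True by (simp add: series_mult_single_add)
next
  case False
  have "exponent3 n i j + b \<noteq> exponent3 n' i' j'" for b
  proof
    assume *: "exponent3 n i j + b = exponent3 n' i' j'"
    have "Poly_Mapping.lookup (exponent3 n i j) v \<le> Poly_Mapping.lookup (exponent3 n' i' j') v" for v
      unfolding * [symmetric] by (simp add: lookup_add)
    from this [of 0] this [of 1] this [of 2] show False
      using False by (simp add: lookup_exponent3)
  qed
  then show ?thesis
    unfolding if_not_P [OF False] by (rule series_mult_single_eq_0)
qed

text \<open>
  The double sum over the terms of \<open>den\<close> in the next lemma factors into two sums of this shape,
  which run over the coefficients of a polynomial instead of the splits of \<open>i\<close>.
\<close>

lemma fps_of_poly_mult_nth:
  fixes U :: "rat poly"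
  shows "(\<Sum>a\<le>degree U. if a \<le> i then coeff U a * g $ (i - a) else 0) = (fps_of_poly U * g) $ i"
proof -
  have "(\<Sum>a\<le>degree U. if a \<le> i then coeff U a * g $ (i - a) else 0) =
      (\<Sum>a\<in>{..degree U} \<inter> {..i}. coeff U a * g $ (i - a))"
    by (simp add: sum.inter_restrict del: Int_atMost)
  also have "\<dots> = (\<Sum>a=0..i. coeff U a * g $ (i - a))"
    by (rule sum.mono_neutral_left) (auto intro: le_degree)
  finally show ?thesis
    by (simp add: fps_mult_nth)
qed

text \<open>
  With the variables \<open>t, y, z\<close>, the rational function is \<open>N(y) / (U(y) V(z) - t)\<close>.  As a geometric
  series in \<open>t\<close> it is the sum of \<open>t\<^sup>n\<close> times \<open>N(y)\<close> over the power \<open>n + 1\<close> of \<open>U(y) V(z)\<close>, so every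
  coefficient is a product of a coefficient in \<open>y\<close> and one in \<open>z\<close>.
\<close>

lemma expansion_three_variables:
  fixes U V N :: "rat poly"
  assumes U: "coeff U 0 \<noteq> 0" and V: "coeff V 0 \<noteq> 0"
  obtains num den c where "expansion_of_quotient 3 num den c"
    "\<And>n i j. c (exponent3 n i j) =
      (fps_of_poly N * inverse (fps_of_poly U) ^ Suc n) $ i * (inverse (fps_of_poly V) ^ Suc n) $ j"
proof -
  define G where "G n = fps_of_poly N * inverse (fps_of_poly U) ^ Suc n" for n
  define H where "H n = inverse (fps_of_poly V) ^ Suc n" for n
  define c :: mseries_rat where "c e = (if Poly_Mapping.keys e \<subseteq> {..<3}
      then G (Poly_Mapping.lookup e 0) $ Poly_Mapping.lookup e 1 *
           H (Poly_Mapping.lookup e 0) $ Poly_Mapping.lookup e 2 else 0)" for e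
  define den where "den = (\<Sum>a\<le>degree U. \<Sum>b\<le>degree V.
      Poly_Mapping.single (exponent3 0 a b) (coeff U a * coeff V b)) - Poly_Mapping.single (exponent3 1 0 0) 1"
  define num where "num = (\<Sum>a\<le>degree N. Poly_Mapping.single (exponent3 0 a 0) (coeff N a))"
  have cancel: "fps_of_poly W * inverse (fps_of_poly W) ^ Suc n = inverse (fps_of_poly W) ^ n"
    if "coeff W 0 \<noteq> 0" for W :: "rat poly" and n
  proof -
    have "fps_of_poly W * inverse (fps_of_poly W) = 1"
      using that by (intro inverse_mult_eq_1') simp
    then show ?thesis
      by (simp add: mult.assoc [symmetric])
  qed
  \<comment> \<open>Multiplying the coefficient of \<open>t\<^sup>n\<close> by \<open>U(y) V(z)\<close> gives that of the previous power of \<open>t\<close>, so all but the lowest term cancel.\<close>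
  have UG: "fps_of_poly U * G n = (if n = 0 then fps_of_poly N else G (n - 1))" for n
  proof -
    have "fps_of_poly U * G n = fps_of_poly N * (fps_of_poly U * inverse (fps_of_poly U) ^ Suc n)"
      unfolding G_def by (simp only: ac_simps)
    then show ?thesis
      unfolding cancel [OF U] by (cases n) (simp_all add: G_def)
  qed
  have VH: "fps_of_poly V * H n = (if n = 0 then 1 else H (n - 1))" for n
    unfolding H_def cancel [OF V] by (cases n) simp_all
  have c3: "c (exponent3 n i j) = G n $ i * H n $ j" for n i j
    using keys_exponent3 by (simp add: c_def lookup_exponent3)
  have num_vars: "in_vars 3 num" and den_vars: "in_vars 3 den"
    unfolding num_def den_def
    by (intro in_vars_diff in_vars_sum in_vars_single keys_exponent3)+
  have c_vars: "series_in_vars 3 c"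
    by (simp add: series_in_vars_def c_def)
  have num3: "Poly_Mapping.lookup num (exponent3 n i j) = (if n = 0 \<and> j = 0 then coeff N i else 0)" for n i j
  proof -
    have "Poly_Mapping.lookup num (exponent3 n i j) =
        (\<Sum>a\<le>degree N. if a = i then (if n = 0 \<and> j = 0 then coeff N i else 0) else 0)"
      unfolding num_def lookup_sum
      by (intro sum.cong) (auto simp: lookup_single when_def exponent3_eq_iff)
    then show ?thesis
      by (simp add: coeff_eq_0)
  qed
  have "den \<noteq> 0"
  proof
    assume "den = 0"
    then have "Poly_Mapping.lookup den (exponent3 1 0 0) = 0"
      by simp
    then show False
      by (simp add: den_def lookup_minus lookup_sum lookup_single exponent3_eq_iff)
  qed
  moreover have "series_mult (Poly_Mapping.lookup den) c = Poly_Mapping.lookup num"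
  proof
    fix e
    show "series_mult (Poly_Mapping.lookup den) c e = Poly_Mapping.lookup num e"
    proof (cases "Poly_Mapping.keys e \<subseteq> {..<3}")
      case False
      then show ?thesis
        using series_in_vars_mult [OF den_vars c_vars] num_vars
        unfolding series_in_vars_def in_vars_iff_lookup by metis
    next
      case True
      then obtain n i j where e: "e = exponent3 n i j"
        using exponent3_lookup by blast
      have "series_mult (Poly_Mapping.lookup den) c e =
          (\<Sum>a\<le>degree U. \<Sum>b\<le>degree V. if a \<le> i \<and> b \<le> j
              then coeff U a * coeff V b * c (exponent3 n (i - a) (j - b)) else 0) -
          (if 1 \<le> n then c (exponent3 (n - 1) i j) else 0)"
        unfolding den_def series_mult_diff series_mult_sum e series_mult_single_exponent3
        by (simp cong: if_cong)
      also have "(\<Sum>a\<le>degree U. \<Sum>b\<le>degree V. if a \<le> i \<and> b \<le> j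
              then coeff U a * coeff V b * c (exponent3 n (i - a) (j - b)) else 0) =
          (\<Sum>a\<le>degree U. if a \<le> i then coeff U a * G n $ (i - a) else 0) *
          (\<Sum>b\<le>degree V. if b \<le> j then coeff V b * H n $ (j - b) else 0)"
        unfolding sum_product by (intro sum.cong refl) (simp add: c3)
      also have "\<dots> = (fps_of_poly U * G n) $ i * (fps_of_poly V * H n) $ j"
        by (simp only: fps_of_poly_mult_nth)
      also have "\<dots> - (if 1 \<le> n then c (exponent3 (n - 1) i j) else 0) = Poly_Mapping.lookup num e"
        unfolding UG VH e num3 c3 by simp
      finally show ?thesis .
    qed
  qed
  ultimately have "expansion_of_quotient 3 num den c"
    using num_vars den_vars c_vars by (simp add: expansion_of_quotient_def)
  then show ?thesis
    using that c3 unfolding G_def H_def by blast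
qed

lemma is_diagonal_nth_mult_nth:
  fixes U V N :: "rat poly"
  assumes "coeff U 0 \<noteq> 0" "coeff V 0 \<noteq> 0"
  shows "is_diagonal (\<lambda>n. (fps_of_poly N * inverse (fps_of_poly U) ^ Suc n) $ n *
                           (inverse (fps_of_poly V) ^ Suc n) $ n)"
proof -
  have diag: "diag_exponent 3 n = exponent3 n n n" for n
    by (rule poly_mapping_eqI) (auto simp: lookup_diag_exponent lookup_exponent3)
  obtain num den and c :: mseries_rat where "expansion_of_quotient 3 num den c" and
    "\<And>n i j. c (exponent3 n i j) =
      (fps_of_poly N * inverse (fps_of_poly U) ^ Suc n) $ i * (inverse (fps_of_poly V) ^ Suc n) $ j"
    by (rule expansion_three_variables [OF assms, of N]) blast
  then show ?thesis
    unfolding is_diagonal_def by (intro exI [of _ 3] conjI exI [of _ num] exI [of _ den] exI [of _ c])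
      (simp_all add: diag del: power_Suc)
qed

section \<open>Rising factorials as coefficients of powers of a rational function\<close>

text \<open>
  With \<open>w = y u = 1 - (1 - y)\<^sup>m\<close>, this says that the derivative of \<open>(1 - y)\<^sup>k / w\<^sup>n\<close> has no residue.
  Here \<open>y\<^sup>n\<close> times that Laurent series is the power series \<open>g = (1 - y)\<^sup>k v\<^sup>n\<close> with \<open>v = 1 / u\<close>, and the
  residue of the derivative is the coefficient of \<open>y\<^sup>n\<close> in \<open>y g' - n g\<close>, which is visibly zero.
\<close>

lemma inverse_power_nth_recurrence:
  fixes u :: "rat fps" and m k n :: nat
  assumes u: "fps_X * u = 1 - (1 - fps_X) ^ m" and u0: "u $ 0 \<noteq> 0"
    and k: "k > 0" and m: "m > 0" and n: "n > 0"
  shows "of_nat (n * m) * ((1 - fps_X) ^ (k - 1) * inverse u ^ Suc n) $ n =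
         (of_nat (n * m) - of_nat k) * ((1 - fps_X) ^ (k - 1) * inverse u ^ n) $ (n - 1)"
proof -
  define v where "v = inverse u"
  define b where "b = 1 - (fps_X :: rat fps)"
  have uv: "u * v = 1"
    unfolding v_def by (rule inverse_mult_eq_1' [OF u0])
  have du: "fps_X * fps_deriv u = of_nat m * b ^ (m - 1) - u"
  proof -
    have "fps_deriv (fps_X * u) = of_nat m * b ^ (m - 1)"
      unfolding u by (simp add: fps_deriv_power' b_def)
    then show ?thesis
      by (simp add: algebra_simps)
  qed
  have dv: "fps_X * fps_deriv v = v - of_nat m * b ^ (m - 1) * v ^ 2"
  proof -
    have "fps_X * fps_deriv v = - (fps_X * fps_deriv u) * v ^ 2"
      unfolding v_def fps_inverse_deriv [OF u0] by simp
    also have "\<dots> = (u * v) * v - of_nat m * b ^ (m - 1) * v ^ 2"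
      unfolding du by (simp add: algebra_simps power2_eq_square)
    finally show ?thesis
      unfolding uv by simp
  qed
  obtain k' where k': "k = Suc k'"
    using k by (cases k) auto
  obtain n' where n': "n = Suc n'"
    using n by (cases n) auto
  let ?g = "b ^ k * v ^ n"
  \<comment> \<open>The relation \<open>(1 - y)\<^sup>m = 1 - w\<close> brings the exponent of \<open>1 - y\<close> back down to \<open>k - 1\<close>.\<close>
  have bm: "b * b ^ (m - 1) = 1 - fps_X * u"
    using m unfolding u b_def by (simp add: power_eq_if)
  have "fps_X * fps_deriv ?g - of_nat n * ?g =
      b ^ k * of_nat n * v ^ n' * (fps_X * fps_deriv v) - of_nat k * fps_X * b ^ k' * v ^ n - of_nat n * ?g"
    by (simp add: fps_deriv_power' k' n' b_def algebra_simps del: power_Suc of_nat_Suc)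
  also have "\<dots> = - (of_nat k * fps_X * b ^ k' * v ^ n)
      - of_nat (n * m) * b ^ k' * (b * b ^ (m - 1)) * v ^ Suc n"
    unfolding dv by (simp add: k' n' algebra_simps power2_eq_square)
  also have "\<dots> = - (of_nat k * fps_X * b ^ k' * v ^ n)
      - of_nat (n * m) * b ^ k' * v ^ Suc n + of_nat (n * m) * b ^ k' * fps_X * (u * v) * v ^ n"
    unfolding bm by (simp add: algebra_simps)
  also have "\<dots> = fps_X * ((of_nat (n * m) - of_nat k) * (b ^ k' * v ^ n))
      - of_nat (n * m) * (b ^ k' * v ^ Suc n)"
    unfolding uv by (simp add: algebra_simps)
  also have "\<dots> = fps_X * (fps_const (of_nat (n * m) - of_nat k) * (b ^ k' * v ^ n))
      - fps_const (of_nat (n * m)) * (b ^ k' * v ^ Suc n)"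
    by (simp add: fps_of_nat [symmetric])
  finally have "(fps_X * fps_deriv ?g - of_nat n * ?g) $ n = \<dots> $ n"
    by (rule arg_cong)
  also have "(fps_X * fps_deriv g - of_nat n * g) $ n = 0" for g :: "rat fps"
    using n by (simp add: fps_of_nat [symmetric])
  also have "(fps_X * (fps_const q * g) - fps_const r * h) $ n = q * g $ (n - 1) - r * h $ n"
    for q r and g h :: "rat fps"
    using n by simp
  finally show ?thesis
    unfolding v_def [symmetric] b_def [symmetric] k' by simp
qed

text \<open>
  The cases \<open>k = 1\<close> and \<open>k = m - 1\<close> give the two parameters \<open>1 - 1/m\<close> and \<open>1/m\<close> of the sequence.
\<close>

lemma inverse_power_nth_eq_pochhammer:
  fixes u :: "rat fps" and m k n :: nat
  assumes u: "fps_X * u = 1 - (1 - fps_X) ^ m" and u0: "u $ 0 = of_nat m"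
    and k: "k > 0" and m: "m > 0"
  shows "of_nat m * ((1 - fps_X) ^ (k - 1) * inverse u ^ Suc n) $ n =
         pochhammer (1 - of_nat k / of_nat m) n / fact n"
proof (induction n)
  case 0
  show ?case
    using m by (simp add: u0 fps_power_zeroth)
next
  case (Suc n)
  have "of_nat (Suc n * m) * ((1 - fps_X) ^ (k - 1) * inverse u ^ Suc (Suc n)) $ Suc n =
      (of_nat (Suc n * m) - of_nat k) * ((1 - fps_X) ^ (k - 1) * inverse u ^ Suc n) $ n"
    using inverse_power_nth_recurrence [OF u _ k m, of "Suc n"] u0 m by simp
  then have "((1 - fps_X) ^ (k - 1) * inverse u ^ Suc (Suc n)) $ Suc n =
      (of_nat (Suc n * m) - of_nat k) * ((1 - fps_X) ^ (k - 1) * inverse u ^ Suc n) $ n / of_nat (Suc n * m)"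
    using m by (intro eq_divide_imp) (simp_all only: mult.commute of_nat_eq_0_iff mult_eq_0_iff, simp)
  then have "of_nat m * ((1 - fps_X) ^ (k - 1) * inverse u ^ Suc (Suc n)) $ Suc n =
      (of_nat (Suc n * m) - of_nat k) / of_nat (Suc n * m) *
      (of_nat m * ((1 - fps_X) ^ (k - 1) * inverse u ^ Suc n) $ n)"
    by (simp del: of_nat_Suc power_Suc)
  also have "(of_nat (Suc n * m) - of_nat k) / of_nat (Suc n * m) =
      (1 - of_nat k / of_nat m + of_nat n) / (of_nat (Suc n) :: rat)"
    using m by (simp add: field_simps)
  finally show ?case
    unfolding Suc.IH by (simp add: pochhammer_rec' mult.commute)
qed

lemma is_diagonal_hyp_seq:
  assumes "m \<ge> 2"
  shows "is_diagonal (hyp_seq m)"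
proof -
  define U :: "rat poly" where "U = (\<Sum>i<m. [:1, -1:] ^ i)"
  \<comment> \<open>The exponent is \<open>k - 1\<close> for \<open>k = m - 1\<close>; the factor \<open>m\<^sup>2\<close> serves both coefficients.\<close>
  define N :: "rat poly" where "N = smult (of_nat m ^ 2) ([:1, -1:] ^ (m - 1 - 1))"
  have b: "fps_of_poly [:1, -1:] = 1 - (fps_X :: rat fps)"
    by (simp add: fps_of_poly_pCons)
  have u: "fps_of_poly U = (\<Sum>i<m. (1 - fps_X) ^ i)"
    by (simp add: U_def fps_of_poly_sum fps_of_poly_power b)
  have Xu: "fps_X * fps_of_poly U = 1 - (1 - fps_X) ^ m"
    unfolding u one_diff_power_eq by simp
  have u0: "fps_of_poly U $ 0 = of_nat m"
    unfolding u by (simp add: fps_sum_nth fps_power_zeroth)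
  have "(\<lambda>n. (fps_of_poly N * inverse (fps_of_poly U) ^ Suc n) $ n *
      (inverse (fps_of_poly U) ^ Suc n) $ n) = hyp_seq m"
  proof
    fix n
    have "(fps_of_poly N * inverse (fps_of_poly U) ^ Suc n) $ n * (inverse (fps_of_poly U) ^ Suc n) $ n =
      (of_nat m * ((1 - fps_X) ^ (m - 1 - 1) * inverse (fps_of_poly U) ^ Suc n) $ n) *
      (of_nat m * ((1 - fps_X) ^ (1 - 1) * inverse (fps_of_poly U) ^ Suc n) $ n)"
      by (simp add: N_def fps_of_poly_smult fps_of_poly_power b power2_eq_square mult.assoc
          del: power_Suc)
    also have "\<dots> = (pochhammer (1 - of_nat (m - 1) / of_nat m) n / fact n) *
        (pochhammer (1 - of_nat 1 / of_nat m) n / fact n)"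
      using assms by (intro arg_cong2 [of _ _ _ _ "(*)"] inverse_power_nth_eq_pochhammer Xu u0) auto
    also have "(1 - of_nat (m - 1) / of_nat m :: rat) = 1 / of_nat m"
      using assms by (simp add: of_nat_diff field_simps)
    finally show "(fps_of_poly N * inverse (fps_of_poly U) ^ Suc n) $ n *
        (inverse (fps_of_poly U) ^ Suc n) $ n = hyp_seq m n"
      by (simp add: hyp_seq_def power2_eq_square)
  qed
  moreover have "coeff U 0 \<noteq> 0"
    using u0 assms by simp
  ultimately show ?thesis
    using is_diagonal_nth_mult_nth [of U U N] by simp
qed

section \<open>Congruences modulo a prime over a subring\<close>

text \<open>
  The ring \<open>R\<close> is kept explicit because the rings of interest, rational numbers or Laurent polynomials
  without \<open>p\<close> in the denominators, live inside rings in which \<open>p\<close> is invertible.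
\<close>

definition cong_in :: "'a::comm_ring_1 set \<Rightarrow> nat \<Rightarrow> 'a \<Rightarrow> 'a \<Rightarrow> bool" where
  "cong_in R p x y \<longleftrightarrow> (\<exists>h\<in>R. x - y = of_nat p * h)"

locale subring_mod_prime =
  fixes R :: "'a::comm_ring_1 set" and p :: nat
  assumes prime: "prime p"
    and one: "1 \<in> R"
    and diff: "x \<in> R \<Longrightarrow> y \<in> R \<Longrightarrow> x - y \<in> R"
    and mult: "x \<in> R \<Longrightarrow> y \<in> R \<Longrightarrow> x * y \<in> R"
begin

lemma zero: "0 \<in> R"
  using diff [OF one one] by simp

lemma add: "x \<in> R \<Longrightarrow> y \<in> R \<Longrightarrow> x + y \<in> R"
  using diff [of x "0 - y"] diff [OF zero, of y] by simp

lemma sum: "(\<And>i. i \<in> A \<Longrightarrow> f i \<in> R) \<Longrightarrow> sum f A \<in> R"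
  by (induction A rule: infinite_finite_induct) (auto simp: zero add)

lemma prod: "(\<And>i. i \<in> A \<Longrightarrow> f i \<in> R) \<Longrightarrow> prod f A \<in> R"
  by (induction A rule: infinite_finite_induct) (auto simp: one mult)

lemma power: "x \<in> R \<Longrightarrow> x ^ n \<in> R"
  by (induction n) (auto simp: one mult)

lemma of_nat: "of_nat n \<in> R"
  by (induction n) (auto simp: zero one add)

lemma cong_in_refl: "cong_in R p x x"
  using zero by (auto simp: cong_in_def intro!: bexI [of _ 0])

lemma cong_in_sym: "cong_in R p x y \<Longrightarrow> cong_in R p y x"
  unfolding cong_in_def using diff [OF zero] by (metis diff_0 minus_diff_eq mult_minus_right)

lemma cong_in_trans [trans]: "cong_in R p x y \<Longrightarrow> cong_in R p y z \<Longrightarrow> cong_in R p x z"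
  unfolding cong_in_def by (metis add diff_add_cancel add_diff_eq distrib_left)

lemma cong_in_add: "cong_in R p x y \<Longrightarrow> cong_in R p x' y' \<Longrightarrow> cong_in R p (x + x') (y + y')"
  unfolding cong_in_def by (metis add add_diff_add distrib_left)

lemma cong_in_mult:
  assumes "cong_in R p x y" "cong_in R p x' y'" "x \<in> R" "y' \<in> R"
  shows "cong_in R p (x * x') (y * y')"
proof -
  obtain h h' where h: "h \<in> R" "h' \<in> R" "x - y = of_nat p * h" "x' - y' = of_nat p * h'"
    using assms by (auto simp: cong_in_def)
  have "x * x' - y * y' = x * (x' - y') + (x - y) * y'"
    by (simp add: algebra_simps)
  also have "\<dots> = of_nat p * (x * h' + h * y')"
    by (simp add: h algebra_simps)
  finally show ?thesis
    using h assms by (auto simp: cong_in_def intro!: add mult)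
qed

lemma cong_in_prod:
  "(\<And>i. i \<in> A \<Longrightarrow> cong_in R p (f i) (g i) \<and> f i \<in> R \<and> g i \<in> R)
    \<Longrightarrow> cong_in R p (prod f A) (prod g A)"
  by (induction A rule: infinite_finite_induct) (auto intro!: cong_in_mult cong_in_refl prod)

lemma cong_in_power:
  "cong_in R p x y \<Longrightarrow> x \<in> R \<Longrightarrow> y \<in> R \<Longrightarrow> cong_in R p (x ^ n) (y ^ n)"
  by (induction n) (auto intro: cong_in_mult cong_in_refl power)

text \<open>
  The inner binomial coefficients are divisible by \<open>p\<close>, and the quotients keep the remainder inside
  \<open>R\<close>.
\<close>

lemma power_add_cong:
  assumes "x \<in> R" "y \<in> R"
  shows "cong_in R p ((x + y) ^ p) (x ^ p + y ^ p)"
proof -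
  have p: "p > 0"
    using prime by (rule prime_gt_0_nat)
  let ?t = "\<lambda>k. of_nat (p choose k) * x ^ k * y ^ (p - k)"
  have "(x + y) ^ p = sum ?t {..p}"
    by (rule binomial_ring)
  also have "{..p} = insert 0 (insert p {0<..<p})"
    using p by auto
  also have "sum ?t \<dots> = x ^ p + y ^ p + sum ?t {0<..<p}"
    using p by (simp add: algebra_simps)
  also have "sum ?t {0<..<p} = of_nat p * (\<Sum>k\<in>{0<..<p}. of_nat ((p choose k) div p) * x ^ k * y ^ (p - k))"
    unfolding sum_distrib_left
  proof (rule sum.cong)
    fix k assume "k \<in> {0<..<p}"
    then have "p dvd p choose k"
      using prime by (intro dvd_choose_prime) auto
    then have "of_nat (p choose k) = (of_nat p * of_nat ((p choose k) div p) :: 'a)"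
      by (metis dvd_mult_div_cancel of_nat_mult)
    then show "?t k = of_nat p * (of_nat ((p choose k) div p) * x ^ k * y ^ (p - k))"
      by (simp add: mult.assoc)
  qed simp
  finally show ?thesis
    using assms by (auto simp: cong_in_def intro!: sum mult power of_nat)
qed

lemma power_sum_cong:
  assumes "finite A" "\<And>i. i \<in> A \<Longrightarrow> f i \<in> R"
  shows "cong_in R p (sum f A ^ p) (\<Sum>i\<in>A. f i ^ p)"
  using assms
proof (induction A rule: finite_induct)
  case empty
  then show ?case
    using prime_gt_0_nat [OF prime] by (simp add: cong_in_refl power_0_left)
next
  case (insert i A)
  have "cong_in R p (sum f (insert i A) ^ p) (f i ^ p + sum f A ^ p)"
    using insert by (simp add: power_add_cong sum)
  also have "cong_in R p \<dots> (f i ^ p + (\<Sum>i\<in>A. f i ^ p))"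
    using insert by (intro cong_in_add cong_in_refl) auto
  finally show ?case
    using insert by simp
qed

text \<open>
  This is what makes the \<open>p\<close>-th power of a Laurent polynomial as sparse as the polynomial itself:
  it will be applied to the decomposition into monomials.
\<close>

lemma power_prime_power_sum_cong:
  assumes "finite A" "\<And>i. i \<in> A \<Longrightarrow> f i \<in> R"
  shows "cong_in R p (sum f A ^ (p ^ k)) (\<Sum>i\<in>A. f i ^ (p ^ k))"
proof (induction k)
  case 0
  show ?case by (simp add: cong_in_refl)
next
  case (Suc k)
  have "cong_in R p ((sum f A ^ (p ^ k)) ^ p) ((\<Sum>i\<in>A. f i ^ (p ^ k)) ^ p)"
    using assms by (intro cong_in_power Suc power sum) auto
  also have "cong_in R p \<dots> (\<Sum>i\<in>A. (f i ^ (p ^ k)) ^ p)"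
    using assms by (intro power_sum_cong power) auto
  finally show ?case
    by (simp add: power_mult [symmetric] mult.commute)
qed

lemma fermat: "cong_in R p (of_nat n ^ p) (of_nat n)"
  using power_sum_cong [of "{..<n}" "\<lambda>_. 1"] by (simp add: one)

end

section \<open>Rational numbers integral at a prime\<close>

definition p_integers :: "nat \<Rightarrow> rat set" where
  "p_integers p = {of_int a / of_nat b | a b. \<not> p dvd b}"

lemma p_integersI: "\<not> p dvd b \<Longrightarrow> x * of_nat b = of_int a \<Longrightarrow> x \<in> p_integers p"
  unfolding p_integers_def
  by (rule CollectI, intro exI [of _ a] exI [of _ b], cases "b = 0") (auto simp: field_simps)

lemma p_integersE:
  assumes "x \<in> p_integers p"
  obtains a b where "\<not> p dvd b" "x * of_nat b = of_int a"
proof -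
  obtain a b where "\<not> p dvd b" "x = of_int a / of_nat b"
    using assms unfolding p_integers_def by blast
  moreover from this have "b \<noteq> 0"
    by (intro notI) simp
  ultimately show ?thesis
    using that [of b a] by simp
qed

lemma subring_p_integers:
  assumes p: "prime p"
  shows "subring_mod_prime (p_integers p) p"
proof
  show "prime p" by fact
  show "1 \<in> p_integers p"
    using p by (intro p_integersI [of _ 1 _ 1]) auto
next
  fix x y assume "x \<in> p_integers p" "y \<in> p_integers p"
  then obtain a b c d where
    ab: "\<not> p dvd b" "x * of_nat b = of_int a" and cd: "\<not> p dvd d" "y * of_nat d = of_int c"
    by (elim p_integersE) blast
  have bd: "\<not> p dvd b * d"
    using ab cd p by (simp add: prime_dvd_mult_iff)
  have "(x - y) * of_nat (b * d) = (x * of_nat b) * of_nat d - (y * of_nat d) * of_nat b"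
    by (simp add: algebra_simps)
  also have "\<dots> = of_int (a * int d - c * int b)"
    by (simp add: ab cd)
  finally show "x - y \<in> p_integers p"
    by (rule p_integersI [OF bd])
  have "(x * y) * of_nat (b * d) = (x * of_nat b) * (y * of_nat d)"
    by (simp add: algebra_simps)
  also have "\<dots> = of_int (a * c)"
    by (simp add: ab cd)
  finally show "x * y \<in> p_integers p"
    by (rule p_integersI [OF bd])
qed

lemma p_integers_divide_of_nat:
  assumes p: "prime p" and x: "x \<in> p_integers p" and n: "\<not> p dvd n"
  shows "x / of_nat n \<in> p_integers p"
proof -
  obtain a b where ab: "\<not> p dvd b" "x * of_nat b = of_int a"
    using x by (rule p_integersE)
  have "n \<noteq> 0"
    using n by (intro notI) simp
  then have "x / of_nat n * of_nat (n * b) = of_int a"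
    using ab by simp
  moreover have "\<not> p dvd n * b"
    using ab n p by (simp add: prime_dvd_mult_iff)
  ultimately show ?thesis
    by (intro p_integersI)
qed

text \<open>
  Congruence over the localization restricts to the usual congruence of integers, since the
  denominator of the cofactor is prime to \<open>p\<close>.
\<close>

lemma p_integers_cong_of_int:
  assumes p: "prime p" and c: "cong_in (p_integers p) p (of_int a) (of_int b)"
  shows "int p dvd a - b"
proof -
  obtain h where h: "h \<in> p_integers p" "(of_int a :: rat) - of_int b = of_nat p * h"
    using c by (auto simp: cong_in_def)
  obtain c d where cd: "\<not> p dvd d" "h * of_nat d = of_int c"
    using h(1) by (rule p_integersE)
  have "(of_int ((a - b) * int d) :: rat) = (of_int a - of_int b) * of_nat d"
    by simp
  also have "\<dots> = of_nat p * (h * of_nat d)"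
    by (simp add: h)
  also have "\<dots> = of_int (int p * c)"
    by (simp add: cd)
  finally have "(a - b) * int d = int p * c"
    by (simp only: of_int_eq_iff)
  then have "int p dvd (a - b) * int d"
    by simp
  then show ?thesis
    using p cd(1) by (auto simp: prime_dvd_mult_iff)
qed

text \<open>
  The ring is local: an element that does not vanish modulo \<open>p\<close> has a numerator prime to \<open>p\<close>, and
  is therefore a unit.
\<close>

lemma p_integers_divide:
  assumes p: "prime p" and x: "x \<in> p_integers p" and y: "y \<in> p_integers p"
    and unit: "\<not> cong_in (p_integers p) p y 0"
  shows "x / y \<in> p_integers p"
proof -
  obtain a b where ab: "\<not> p dvd b" "y * of_nat b = of_int a"
    using y by (rule p_integersE)
  have b0: "b \<noteq> 0"
    using ab(1) by (intro notI) simp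
  have na: "\<not> int p dvd a"
  proof
    assume "int p dvd a"
    then obtain c where "a = int p * c" ..
    then have "y - 0 = of_nat p * (of_int c / of_nat b)"
      using ab(2) b0 by (simp add: field_simps)
    moreover have "of_int c / of_nat b \<in> p_integers p"
      using ab(1) b0 by (intro p_integersI [of p b _ c]) auto
    ultimately show False
      using unit unfolding cong_in_def by blast
  qed
  obtain c d where cd: "\<not> p dvd d" "x * of_nat d = of_int c"
    using x by (rule p_integersE)
  have "\<not> p dvd nat \<bar>a\<bar>"
    using na by (simp add: int_dvd_int_iff [symmetric])
  then have "\<not> p dvd nat \<bar>a\<bar> * d"
    using cd(1) p by (simp add: prime_dvd_mult_iff)
  moreover have "x / y * of_nat (nat \<bar>a\<bar> * d) = of_int (sgn a * int b * c)"
  proof -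
    have "y \<noteq> 0"
      using na ab(2) by (intro notI) simp
    have "of_nat (nat \<bar>a\<bar>) = (of_int (sgn a * a) :: rat)"
      by (simp add: sgn_if abs_if)
    then have "x / y * of_nat (nat \<bar>a\<bar> * d) = x / y * of_int (sgn a * a) * of_nat d"
      by (simp only: of_nat_mult mult.assoc)
    also have "\<dots> = x / y * of_int (sgn a) * (y * of_nat b) * of_nat d"
      by (simp add: ab(2))
    also have "\<dots> = of_int (sgn a) * of_nat b * (x * of_nat d)"
      using \<open>y \<noteq> 0\<close> by simp
    finally show ?thesis
      by (simp add: cd(2))
  qed
  ultimately show ?thesis
    by (rule p_integersI)
qed

text \<open>
  Fermat's theorem for integers carries over after multiplication by the denominator \<open>b\<close>, because
  \<open>b\<close> and its \<open>p\<close>-th power are congruent and \<open>b\<close> is a unit.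
\<close>

lemma p_integers_fermat:
  assumes p: "prime p" and x: "x \<in> p_integers p"
  shows "cong_in (p_integers p) p (x ^ p) x"
proof -
  interpret subring_mod_prime "p_integers p" p
    by (rule subring_p_integers [OF p])
  obtain a b where ab: "\<not> p dvd b" "x * of_nat b = of_int a"
    using x by (rule p_integersE)
  let ?n = "nat (a mod int p)"
  have "int p * (a div int p) + int ?n = a"
    using prime_gt_0_nat [OF p] by simp
  then have "(of_int a :: rat) = of_nat p * of_int (a div int p) + of_nat ?n"
    by (metis of_int_add of_int_mult of_int_of_nat_eq)
  moreover have "(of_int (a div int p) :: rat) \<in> p_integers p"
    using p by (intro p_integersI [of _ 1]) auto
  ultimately have an: "cong_in (p_integers p) p (of_int a) (of_nat ?n)"
    by (auto simp: cong_in_def)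
  have a: "of_int a \<in> p_integers p"
    using p by (intro p_integersI [of _ 1]) auto
  \<comment> \<open>It suffices to prove the congruence after multiplying both sides by \<open>b\<close>.\<close>
  have "cong_in (p_integers p) p (x ^ p * of_nat b) (x ^ p * of_nat b ^ p)"
    by (intro cong_in_mult cong_in_refl power x of_nat cong_in_sym [OF fermat])
  also have "x ^ p * of_nat b ^ p = of_int a ^ p"
    using ab by (simp add: power_mult_distrib [symmetric])
  also have "cong_in (p_integers p) p \<dots> (of_nat ?n ^ p)"
    by (intro cong_in_power an a of_nat)
  also have "cong_in (p_integers p) p \<dots> (of_nat ?n)"
    by (rule fermat)
  also have "cong_in (p_integers p) p \<dots> (x * of_nat b)"
    using cong_in_sym [OF an] ab by simp
  finally obtain h where h: "h \<in> p_integers p" "(x ^ p - x) * of_nat b = of_nat p * h"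
    by (auto simp: cong_in_def algebra_simps)
  have "b \<noteq> 0"
    using ab(1) by (intro notI) simp
  then have "x ^ p - x = of_nat p * (h / of_nat b)"
    using h(2) by (simp add: field_simps)
  then show ?thesis
    unfolding cong_in_def using p_integers_divide_of_nat [OF p h(1) ab(1)] by blast
qed

section \<open>Constant terms of prime powers\<close>

lemma poly_mapping_eq_sum_single:
  "F = (\<Sum>e\<in>Poly_Mapping.keys F. Poly_Mapping.single e (Poly_Mapping.lookup F e))"
proof (rule poly_mapping_eqI)
  fix a
  have "Poly_Mapping.lookup (\<Sum>e\<in>Poly_Mapping.keys F. Poly_Mapping.single e (Poly_Mapping.lookup F e)) a =
      (\<Sum>e\<in>Poly_Mapping.keys F. if e = a then Poly_Mapping.lookup F a else 0)"
    unfolding lookup_sum by (intro sum.cong) (auto simp: lookup_single when_def)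
  then show "Poly_Mapping.lookup F a = Poly_Mapping.lookup
      (\<Sum>e\<in>Poly_Mapping.keys F. Poly_Mapping.single e (Poly_Mapping.lookup F e)) a"
    by (simp add: in_keys_iff)
qed

lemma mult_eq_sum_single:
  fixes F G :: "'a::monoid_add \<Rightarrow>\<^sub>0 'b::semiring_0"
  shows "F * G = (\<Sum>a\<in>Poly_Mapping.keys F. \<Sum>b\<in>Poly_Mapping.keys G.
    Poly_Mapping.single (a + b) (Poly_Mapping.lookup F a * Poly_Mapping.lookup G b))"
proof -
  have "F * G = (\<Sum>a\<in>Poly_Mapping.keys F. Poly_Mapping.single a (Poly_Mapping.lookup F a)) *
      (\<Sum>b\<in>Poly_Mapping.keys G. Poly_Mapping.single b (Poly_Mapping.lookup G b))"
    by (simp only: poly_mapping_eq_sum_single [symmetric])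
  then show ?thesis
    by (simp add: sum_product mult_single)
qed

lemma single_power:
  "Poly_Mapping.single (e :: 'a::comm_monoid_add) (c :: 'b::comm_semiring_1) ^ n =
     Poly_Mapping.single (\<Sum>i<n. e) (c ^ n)"
  by (induction n) (simp_all add: mult_single add.commute)

text \<open>
  Powers of a monomial produce multiples of its exponent vector in the form of constant sums, which
  are kept in this form: rewritten as products they would be convolutions.
\<close>

lemma lookup_sum_const:
  "Poly_Mapping.lookup (\<Sum>i<n. e) v = of_nat n * Poly_Mapping.lookup (e :: 'a \<Rightarrow>\<^sub>0 'b::semiring_1) v"
  unfolding lookup_sum by simp

lemma lookup_single_mult_zero:
  fixes Q :: laurent_rat
  shows "Poly_Mapping.lookup (Poly_Mapping.single a c * Q) 0 = c * Poly_Mapping.lookup Q (- a)"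
proof -
  have "Poly_Mapping.single a c * Q =
      (\<Sum>b\<in>Poly_Mapping.keys Q. Poly_Mapping.single (a + b) (c * Poly_Mapping.lookup Q b))"
    by (subst poly_mapping_eq_sum_single [of Q]) (simp add: sum_distrib_left mult_single)
  then have "Poly_Mapping.lookup (Poly_Mapping.single a c * Q) 0 =
      (\<Sum>b\<in>Poly_Mapping.keys Q. if b = - a then c * Poly_Mapping.lookup Q (- a) else 0)"
    by (auto simp: lookup_sum lookup_single when_def add_eq_0_iff intro!: sum.cong)
  then show ?thesis
    by (simp add: in_keys_iff)
qed

definition p_integral_laurent :: "nat \<Rightarrow> laurent_rat set" where
  "p_integral_laurent p = {F. \<forall>e. Poly_Mapping.lookup F e \<in> p_integers p}"

lemma subring_p_integral_laurent:
  assumes p: "prime p"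
  shows "subring_mod_prime (p_integral_laurent p) p"
proof -
  interpret Z: subring_mod_prime "p_integers p" p
    by (rule subring_p_integers [OF p])
  show ?thesis
  proof
    show "prime p" by fact
    show "1 \<in> p_integral_laurent p"
      by (auto simp: p_integral_laurent_def lookup_one when_def Z.one Z.zero)
  next
    fix F G assume FG: "F \<in> p_integral_laurent p" "G \<in> p_integral_laurent p"
    then show "F - G \<in> p_integral_laurent p"
      by (auto simp: p_integral_laurent_def lookup_minus intro: Z.diff)
    have "Poly_Mapping.lookup (F * G) e \<in> p_integers p" for e
      unfolding mult_eq_sum_single lookup_sum
      using FG by (auto simp: p_integral_laurent_def lookup_single when_def
          intro!: Z.sum Z.mult Z.zero)
    then show "F * G \<in> p_integral_laurent p"
      by (simp add: p_integral_laurent_def)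
  qed
qed

lemma ct_cong:
  assumes "cong_in (p_integral_laurent p) p F G"
  shows "cong_in (p_integers p) p (ct F) (ct G)"
proof -
  obtain h where h: "h \<in> p_integral_laurent p" "F - G = of_nat p * h"
    using assms by (auto simp: cong_in_def)
  have "ct (of_nat n * h) = of_nat n * ct h" for n
    by (induction n) (simp_all add: ct_def lookup_add algebra_simps)
  then have "ct F - ct G = of_nat p * ct h"
    using h(2) by (simp add: ct_def lookup_minus [symmetric])
  then show ?thesis
    using h(1) by (auto simp: cong_in_def p_integral_laurent_def ct_def)
qed

text \<open>
  Modulo \<open>p\<close>, the power of \<open>P\<close> is a combination of monomials whose exponents are multiples of
  \<open>p\<close>.  The exponents of \<open>Q\<close> are too small to cancel any of them except the trivial one.
\<close>

lemma ct_prime_power_cong: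
  assumes p: "prime p" and k: "k > 0"
    and P: "P \<in> p_integral_laurent p" and Q: "Q \<in> p_integral_laurent p"
    and small: "\<And>e v. e \<in> Poly_Mapping.keys Q \<Longrightarrow> \<bar>Poly_Mapping.lookup e v\<bar> < int p"
  shows "cong_in (p_integers p) p (ct (P ^ (p ^ k) * Q)) (ct P * ct Q)"
proof -
  interpret Z: subring_mod_prime "p_integers p" p
    by (rule subring_p_integers [OF p])
  interpret L: subring_mod_prime "p_integral_laurent p" p
    by (rule subring_p_integral_laurent [OF p])
  let ?c = "Poly_Mapping.lookup P" and ?q = "p ^ k"
  let ?F = "\<Sum>e\<in>Poly_Mapping.keys P. Poly_Mapping.single (\<Sum>i<?q. e) (?c e ^ ?q)"
  have q0: "?q > 0"
    using prime_gt_0_nat [OF p] by simp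
  have "cong_in (p_integral_laurent p) p
      ((\<Sum>e\<in>Poly_Mapping.keys P. Poly_Mapping.single e (?c e)) ^ ?q)
      (\<Sum>e\<in>Poly_Mapping.keys P. Poly_Mapping.single e (?c e) ^ ?q)"
    using P by (intro L.power_prime_power_sum_cong)
      (auto simp: p_integral_laurent_def lookup_single when_def Z.zero)
  then have "cong_in (p_integral_laurent p) p (P ^ ?q) ?F"
    by (simp only: poly_mapping_eq_sum_single [symmetric] single_power)
  then have "cong_in (p_integral_laurent p) p (P ^ ?q * Q) (?F * Q)"
    by (intro L.cong_in_mult L.cong_in_refl L.power P Q)
  then have "cong_in (p_integers p) p (ct (P ^ ?q * Q)) (ct (?F * Q))"
    by (rule ct_cong)
  also have "ct (?F * Q) = (\<Sum>e\<in>Poly_Mapping.keys P. ?c e ^ ?q * Poly_Mapping.lookup Q (- (\<Sum>i<?q. e)))"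
    by (simp add: ct_def sum_distrib_right lookup_sum lookup_single_mult_zero)
  also have "\<dots> = (\<Sum>e\<in>Poly_Mapping.keys P. if e = 0 then ct P ^ ?q * ct Q else 0)"
  proof (intro sum.cong refl)
    fix e
    show "?c e ^ ?q * Poly_Mapping.lookup Q (- (\<Sum>i<?q. e)) = (if e = 0 then ct P ^ ?q * ct Q else 0)"
    proof (cases "e = 0")
      case True
      then show ?thesis
        by (simp add: ct_def)
    next
      case False
      then obtain v where v: "Poly_Mapping.lookup e v \<noteq> 0"
        by (metis poly_mapping_eqI lookup_zero)
      \<comment> \<open>A nonzero exponent, multiplied by \<open>p\<^sup>k\<close>, leaves the range of the exponents of \<open>Q\<close>.\<close>
      have "int p * 1 \<le> int ?q * \<bar>Poly_Mapping.lookup e v\<bar>"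
        using v k prime_gt_0_nat [OF p] by (intro mult_mono) (auto simp: self_le_power)
      then have "int p \<le> \<bar>Poly_Mapping.lookup (- (\<Sum>i<?q. e)) v\<bar>"
        by (simp add: lookup_sum_const abs_mult del: sum_constant)
      then have "- (\<Sum>i<?q. e) \<notin> Poly_Mapping.keys Q"
        using small [of "- (\<Sum>i<?q. e)" v] by linarith
      then show ?thesis
        using False by (simp add: in_keys_iff)
    qed
  qed
  also have "\<dots> = ct P ^ ?q * ct Q"
    using prime_gt_0_nat [OF p] by (auto simp: ct_def in_keys_iff power_0_left)
  also have "cong_in (p_integers p) p \<dots> (ct P * ct Q)"
  proof -
    have ctR: "ct P \<in> p_integers p" "ct Q \<in> p_integers p"
      using P Q by (auto simp: p_integral_laurent_def ct_def)
    have "cong_in (p_integers p) p (ct P ^ (p ^ l)) (ct P)" for l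
    proof (induction l)
      case (Suc l)
      have "cong_in (p_integers p) p ((ct P ^ (p ^ l)) ^ p) (ct P ^ p)"
        by (intro Z.cong_in_power Suc Z.power ctR)
      also have "cong_in (p_integers p) p (ct P ^ p) (ct P)"
        by (rule p_integers_fermat [OF p ctR(1)])
      finally show ?case
        by (simp add: power_mult [symmetric] mult.commute)
    qed (simp add: Z.cong_in_refl)
    then show ?thesis
      by (intro Z.cong_in_mult Z.cong_in_refl Z.power ctR)
  qed
  finally show ?thesis .
qed

lemma eventually_in_p_integers:
  "\<forall>\<^sub>F p in sequentially. prime p \<longrightarrow> x \<in> p_integers p"
proof -
  obtain a b where ab: "x = of_int a / of_int b" "b > 0"
    by (metis quotient_of_div quotient_of_denom_pos surj_pair)
  show ?thesis
    using eventually_gt_at_top [of "nat b"]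
  proof eventually_elim
    case (elim p)
    then have "\<not> p dvd nat b"
      using ab(2) by (auto dest: dvd_imp_le)
    then show ?case
      using ab by (intro impI p_integersI [of p "nat b" x a]) auto
  qed
qed

lemma eventually_p_integral_laurent:
  "\<forall>\<^sub>F p in sequentially. prime p \<longrightarrow> F \<in> p_integral_laurent p"
proof -
  have "\<forall>\<^sub>F p in sequentially. \<forall>e\<in>Poly_Mapping.keys F. prime p \<longrightarrow> Poly_Mapping.lookup F e \<in> p_integers p"
    by (intro eventually_ball_finite ballI eventually_in_p_integers) simp
  then show ?thesis
  proof eventually_elim
    case (elim p)
    show ?case
    proof
      assume p: "prime p"
      then interpret Z: subring_mod_prime "p_integers p" p
        by (rule subring_p_integers)
      show "F \<in> p_integral_laurent p"
        unfolding p_integral_laurent_def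
      proof (intro CollectI allI)
        show "Poly_Mapping.lookup F e \<in> p_integers p" for e
          using elim p Z.zero by (cases "e \<in> Poly_Mapping.keys F") (auto simp: in_keys_iff)
      qed
    qed
  qed
qed

text \<open>
  For large \<open>p\<close> both values are congruent to \<open>ct P * ct Q\<close>, independently of the exponent of \<open>p\<close>.
\<close>

lemma constant_term_prime_square_cong:
  assumes "is_constant_term A"
  shows "\<forall>\<^sub>F p in sequentially. prime p \<longrightarrow> cong_in (p_integers p) p (A p) (A (p * p))"
proof -
  obtain P Q :: laurent_rat where A: "\<And>n. A n = ct (P ^ n * Q)"
    using assms by (auto simp: is_constant_term_def)
  have "\<forall>\<^sub>F p in sequentially. \<bar>Poly_Mapping.lookup e v\<bar> < int p" for e :: "nat \<Rightarrow>\<^sub>0 int" and v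
    using eventually_gt_at_top [of "nat \<bar>Poly_Mapping.lookup e v\<bar>"] by eventually_elim linarith
  then have "\<forall>\<^sub>F p in sequentially. \<forall>e\<in>Poly_Mapping.keys Q. \<forall>v\<in>Poly_Mapping.keys e.
      \<bar>Poly_Mapping.lookup e v\<bar> < int p"
    by (intro eventually_ball_finite ballI) auto
  then show ?thesis
    using eventually_p_integral_laurent [of P] eventually_p_integral_laurent [of Q]
  proof eventually_elim
    case (elim p)
    show ?case
    proof
      assume p: "prime p"
      interpret Z: subring_mod_prime "p_integers p" p
        by (rule subring_p_integers [OF p])
      have "\<bar>Poly_Mapping.lookup e v\<bar> < int p" if "e \<in> Poly_Mapping.keys Q" for e v
        using elim(1) that prime_gt_0_nat [OF p]
        by (cases "v \<in> Poly_Mapping.keys e") (auto simp: in_keys_iff)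
      then have *: "cong_in (p_integers p) p (A (p ^ k)) (ct P * ct Q)" if "k > 0" for k
        unfolding A using p that elim by (intro ct_prime_power_cong) auto
      have "cong_in (p_integers p) p (A (p ^ 1)) (A (p ^ 2))"
        by (rule Z.cong_in_trans [OF * Z.cong_in_sym [OF *]]) simp_all
      then show "cong_in (p_integers p) p (A p) (A (p * p))"
        by (simp add: power2_eq_square)
    qed
  qed
qed

section \<open>Dwork's congruence\<close>

text \<open>
  Modulo \<open>p\<close>, \<open>a\<close> is \<open>-j\<close>, so the factors run through all nonzero residues.
\<close>

lemma prod_shifted_residues_cong:
  assumes p: "prime p" and j: "j < p" and a: "a \<in> p_integers p"
    and aj: "cong_in (p_integers p) p (a + of_nat j) 0"
  shows "cong_in (p_integers p) p (\<Prod>t\<in>{..<p} - {j}. a + of_nat t) (fact (p - 1))"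
proof -
  interpret subring_mod_prime "p_integers p" p
    by (rule subring_p_integers [OF p])
  let ?g = "\<lambda>t. (t + (p - j)) mod p"
  have p0: "p > 0"
    using p by (rule prime_gt_0_nat)
  \<comment> \<open>The residue of \<open>t - j\<close>, shifted by \<open>p\<close> to stay within the natural numbers.\<close>
  have bij: "bij_betw ?g ({..<p} - {j}) {1..p - 1}"
  proof (rule bij_betw_byWitness [where f' = "\<lambda>s. (s + j) mod p"])
    show "\<forall>t\<in>{..<p} - {j}. (?g t + j) mod p = t"
      using j by (auto simp: mod_add_left_eq)
    have "?g ((s + j) mod p) = s" if "s < p" for s
      unfolding mod_add_left_eq using that j by simp
    moreover have "s < p" if "s \<in> {1..p - 1}" for s
      using that p0 by auto
    ultimately show "\<forall>s\<in>{1..p - 1}. ?g ((s + j) mod p) = s"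
      by blast
    have "?g t \<in> {1..p - 1}" if "t \<in> {..<p} - {j}" for t
    proof -
      have "?g t \<noteq> 0"
        using that j by (cases "t < j") (auto simp: le_mod_geq)
      moreover have "?g t < p"
        using p0 by simp
      ultimately show ?thesis
        unfolding atLeastAtMost_iff by linarith
    qed
    then show "?g ` ({..<p} - {j}) \<subseteq> {1..p - 1}"
      by (intro image_subsetI)
    have "(s + j) mod p \<in> {..<p} - {j}" if "s \<in> {1..p - 1}" for s
    proof -
      have s: "0 < s" "s < p"
        using that p0 by auto
      have "(s + j) mod p = (if s + j < p then s + j else s + j - p)"
        using s j by (simp add: mod_if [of "s + j"])
      then have "(s + j) mod p \<noteq> j"
        using s by (simp split: if_splits)
      then show ?thesis
        using p0 by simp
    qed
    then show "(\<lambda>s. (s + j) mod p) ` {1..p - 1} \<subseteq> {..<p} - {j}"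
      by (intro image_subsetI)
  qed
  have residue: "cong_in (p_integers p) p (a + of_nat t) (of_nat (?g t))" for t
  proof -
    obtain h where h: "h \<in> p_integers p" "a + of_nat j = of_nat p * h"
      using aj by (auto simp: cong_in_def)
    let ?q = "(t + (p - j)) div p"
    have "?q * p + ?g t = t + (p - j)"
      by simp
    then have "of_nat ?q * of_nat p + of_nat (?g t) = of_nat t + (of_nat p - of_nat j :: rat)"
      using j by (metis less_imp_le of_nat_add of_nat_diff of_nat_mult)
    then have "a + of_nat t - of_nat (?g t) = of_nat p * (h + of_nat ?q - 1)"
      using h(2) by (simp add: algebra_simps)
    then show ?thesis
      using h(1) by (auto simp: cong_in_def intro!: add diff one of_nat)
  qed
  have "cong_in (p_integers p) p (\<Prod>t\<in>{..<p} - {j}. a + of_nat t) (\<Prod>t\<in>{..<p} - {j}. of_nat (?g t))"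
    by (intro cong_in_prod conjI residue add a of_nat)
  also have "(\<Prod>t\<in>{..<p} - {j}. of_nat (?g t)) = (\<Prod>s\<in>{1..p - 1}. of_nat s :: rat)"
    by (rule prod.reindex_bij_betw [OF bij])
  also have "\<dots> = fact (p - 1)"
    by (simp add: fact_prod)
  finally show ?thesis .
qed

text \<open>
  Among \<open>p\<close> consecutive factors \<open>a + i\<close>, exactly one is divisible by \<open>p\<close>, namely the one with \<open>i = j\<close>
  modulo \<open>p\<close>.  These factors together make up \<open>p\<^sup>n (a')\<^sub>n\<close>, and the others contribute \<open>(p - 1)!\<close> modulo
  \<open>p\<close> for each of the \<open>n\<close> blocks.
\<close>

lemma pochhammer_prime_multiple:
  assumes p: "prime p" and j: "j < p" and a: "a \<in> p_integers p" and a': "a' \<in> p_integers p"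
    and aj: "a + of_nat j = of_nat p * a'"
  obtains W where "W \<in> p_integers p" "cong_in (p_integers p) p W (fact (p - 1) ^ n)"
    "pochhammer a (p * n) = of_nat p ^ n * pochhammer a' n * W"
proof -
  interpret subring_mod_prime "p_integers p" p
    by (rule subring_p_integers [OF p])
  have "\<exists>W\<in>p_integers p. cong_in (p_integers p) p W (fact (p - 1) ^ n) \<and>
      pochhammer a (p * n) = of_nat p ^ n * pochhammer a' n * W"
  proof (induction n)
    case 0
    show ?case
      by (auto intro!: bexI [of _ 1] one cong_in_refl)
  next
    case (Suc n)
    then obtain W where W: "W \<in> p_integers p" "cong_in (p_integers p) p W (fact (p - 1) ^ n)"
      "pochhammer a (p * n) = of_nat p ^ n * pochhammer a' n * W"
      by blast
    let ?b = "a + of_nat (p * n)"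
    let ?V = "\<Prod>t\<in>{..<p} - {j}. ?b + of_nat t"
    have b: "?b \<in> p_integers p"
      by (intro add a of_nat)
    have bj: "?b + of_nat j = of_nat p * (a' + of_nat n)"
      using aj by (simp add: algebra_simps)
    then have "cong_in (p_integers p) p (?b + of_nat j) 0"
      using a' by (auto simp: cong_in_def intro!: add of_nat)
    then have V: "cong_in (p_integers p) p ?V (fact (p - 1))"
      using p j b by (intro prod_shifted_residues_cong)
    have VR: "?V \<in> p_integers p"
      by (intro prod add b of_nat)
    have "pochhammer a (p * Suc n) = pochhammer a (p * n) * pochhammer ?b p"
      using pochhammer_product' [of a "p * n" p] by (simp add: add.commute)
    also have "pochhammer ?b p = (\<Prod>t<p. ?b + of_nat t)"
      by (simp add: pochhammer_prod atLeast0LessThan)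
    also have "\<dots> = (?b + of_nat j) * ?V"
      using j by (intro prod.remove) auto
    also have "pochhammer a (p * n) * \<dots> =
        of_nat p ^ Suc n * pochhammer a' (Suc n) * (W * ?V)"
      unfolding bj W(3) by (simp add: pochhammer_rec' algebra_simps)
    finally have "pochhammer a (p * Suc n) = \<dots>" .
    moreover have "cong_in (p_integers p) p (W * ?V) (fact (p - 1) ^ n * fact (p - 1))"
      using W V of_nat [of "fact (p - 1)"] by (intro cong_in_mult) auto
    moreover have "W * ?V \<in> p_integers p"
      by (intro mult W VR)
    ultimately show ?case
      by (auto simp: mult.commute)
  qed
  then show ?thesis
    using that by blast
qed

text \<open>
  Up to the sign \<open>(-1)\<^sup>n\<close>, this is the binomial coefficient of \<open>-a\<close> over \<open>n\<close>, that is, the coefficient of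
  \<open>x\<^sup>n\<close> in \<open>(1 - x)\<close> to the power \<open>-a\<close>.
\<close>

definition pochhammer_quotient :: "rat \<Rightarrow> nat \<Rightarrow> rat" where
  "pochhammer_quotient a n = pochhammer a n / fact n"

text \<open>
  Numerator and denominator are treated alike, since \<open>n! = (1)\<^sub>n\<close> and the parameter \<open>a = 1\<close> corresponds
  to \<open>a' = 1\<close>: the powers of \<open>p\<close> cancel, and so do the factors prime to \<open>p\<close> modulo \<open>p\<close>.
\<close>

lemma pochhammer_quotient_prime_multiple:
  assumes p: "prime p" and j: "j < p" and a: "a \<in> p_integers p" and a': "a' \<in> p_integers p"
    and aj: "a + of_nat j = of_nat p * a'"
    and quot: "pochhammer_quotient a' n \<in> p_integers p"
  shows "pochhammer_quotient a (p * n) \<in> p_integers p"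
    and "cong_in (p_integers p) p (pochhammer_quotient a (p * n)) (pochhammer_quotient a' n)"
proof -
  interpret subring_mod_prime "p_integers p" p
    by (rule subring_p_integers [OF p])
  have p0: "p > 0"
    using p by (rule prime_gt_0_nat)
  obtain W where W: "W \<in> p_integers p" "cong_in (p_integers p) p W (fact (p - 1) ^ n)"
    "pochhammer a (p * n) = of_nat p ^ n * pochhammer a' n * W"
    using p j a a' aj by (rule pochhammer_prime_multiple)
  \<comment> \<open>The case \<open>a = 1\<close>: here \<open>j = p - 1\<close> and \<open>a' = 1\<close>.\<close>
  have 1: "p - 1 < p" "1 + of_nat (p - 1) = (of_nat p * 1 :: rat)"
    using p0 by (simp_all add: of_nat_diff)
  obtain V where V: "V \<in> p_integers p" "cong_in (p_integers p) p V (fact (p - 1) ^ n)"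
    "pochhammer 1 (p * n) = of_nat p ^ n * pochhammer 1 n * V"
    using p 1(1) one one 1(2) by (rule pochhammer_prime_multiple)
  have fact_cop: "\<not> p dvd fact (p - 1) ^ n"
    using prime_dvd_power [OF p, of "fact (p - 1)" n] p p0 by (auto simp: prime_dvd_fact_iff)
  have V0: "V \<noteq> 0"
  proof
    assume "V = 0"
    then have "fact (p * n) = (0 :: rat)"
      unfolding pochhammer_fact V(3) by (rule ssubst) (rule mult_zero_right)
    then show False
      by (simp only: fact_nonzero)
  qed
  have "\<not> cong_in (p_integers p) p V 0"
  proof
    assume "cong_in (p_integers p) p V 0"
    then have "cong_in (p_integers p) p (fact (p - 1) ^ n) 0"
      by (rule cong_in_trans [OF cong_in_sym [OF V(2)]])
    then have "int p dvd fact (p - 1) ^ n - 0"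
      by (intro p_integers_cong_of_int [OF p]) simp
    then show False
      using fact_cop by (metis diff_zero int_dvd_int_iff of_nat_fact of_nat_power)
  qed
  then have Vunit: "x / V \<in> p_integers p" if "x \<in> p_integers p" for x
    using p that V(1) by (intro p_integers_divide)
  have quot_eq: "pochhammer_quotient a (p * n) = pochhammer_quotient a' n * (W / V)"
    unfolding pochhammer_quotient_def pochhammer_fact W(3) V(3) using p0 by simp
  show "pochhammer_quotient a (p * n) \<in> p_integers p"
    unfolding quot_eq by (intro mult quot Vunit W)
  have "cong_in (p_integers p) p W V"
    using W(2) V(2) by (blast intro: cong_in_trans cong_in_sym)
  then obtain h where h: "h \<in> p_integers p" "W - V = of_nat p * h"
    by (auto simp: cong_in_def)
  have "pochhammer_quotient a (p * n) - pochhammer_quotient a' n =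
      pochhammer_quotient a' n * ((W - V) / V)"
    unfolding quot_eq using V0 by (simp add: field_simps)
  also have "\<dots> = of_nat p * (pochhammer_quotient a' n * (h / V))"
    by (simp add: h)
  finally show "cong_in (p_integers p) p (pochhammer_quotient a (p * n)) (pochhammer_quotient a' n)"
    unfolding cong_in_def using mult [OF quot Vunit [OF h(1)]] by blast
qed

text \<open>
  The map \<open>a \<mapsto> a'\<close> divides the numerator \<open>k\<close> by \<open>p\<close> modulo \<open>m\<close>.  It commutes with \<open>a \<mapsto> 1 - a\<close>,
  which replaces \<open>j\<close> by \<open>p - 1 - j\<close>, so that both factors of the sequence keep their
  complementary form.
\<close>

lemma pochhammer_quotient_dwork_step:
  fixes m k p :: nat
  assumes p: "prime p" and m: "m < p" and k: "0 < k" "k < m"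
  obtains k' where "0 < k'" "k' < m" "[p * k' = k] (mod m)"
    "\<And>n. pochhammer_quotient (of_nat k' / of_nat m) n \<in> p_integers p \<Longrightarrow>
      pochhammer_quotient (of_nat k / of_nat m) (p * n) \<in> p_integers p \<and>
      cong_in (p_integers p) p (pochhammer_quotient (of_nat k / of_nat m) (p * n))
        (pochhammer_quotient (of_nat k' / of_nat m) n)"
    "\<And>n. pochhammer_quotient (1 - of_nat k' / of_nat m) n \<in> p_integers p \<Longrightarrow>
      pochhammer_quotient (1 - of_nat k / of_nat m) (p * n) \<in> p_integers p \<and>
      cong_in (p_integers p) p (pochhammer_quotient (1 - of_nat k / of_nat m) (p * n))
        (pochhammer_quotient (1 - of_nat k' / of_nat m) n)"
proof -
  interpret subring_mod_prime "p_integers p" p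
    by (rule subring_p_integers [OF p])
  have p0: "p > 0"
    using p by (rule prime_gt_0_nat)
  have pm: "\<not> p dvd m"
    using m k by (auto dest: dvd_imp_le)
  then have "coprime m p"
    using p by (metis coprime_commute prime_imp_coprime)
  then obtain x where x: "[m * x = 1] (mod p)"
    using cong_solve_coprime_nat by auto
  \<comment> \<open>The solution of \<open>k + j m = 0\<close> modulo \<open>p\<close>, with \<open>p - k\<close> standing for \<open>-k\<close>.\<close>
  let ?j = "((p - k) * x) mod p"
  have j: "?j < p"
    using p0 by simp
  have "[k + ?j * m = k + (p - k) * x * m] (mod p)"
    by (intro cong_add cong_mult cong_refl) (simp add: cong_def)
  also have "k + (p - k) * x * m = k + (p - k) * (m * x)"
    by (simp add: ac_simps)
  also have "[k + (p - k) * (m * x) = k + (p - k) * 1] (mod p)"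
    by (intro cong_add cong_mult cong_refl x)
  finally have "p dvd k + ?j * m"
    using m k by (simp add: cong_def dvd_eq_mod_eq_0)
  then obtain k' where k': "k + ?j * m = p * k'" ..
  have "?j * m \<le> (p - 1) * m"
    using j by (intro mult_right_mono) auto
  moreover have "p * m = m + (p - 1) * m"
    using p0 mult_Suc [of "p - 1" m] by simp
  ultimately have "p * k' < p * m"
    using k' k by linarith
  then have "k' < m"
    by simp
  moreover have "0 < k'"
    using k' k by (cases k') auto
  moreover have "[p * k' = k] (mod m)"
    unfolding k' [symmetric] by (simp add: cong_def)
  moreover
  have int: "of_nat l / of_nat m \<in> p_integers p" for l
    by (intro p_integers_divide_of_nat p of_nat pm)
  have eq: "of_nat k / of_nat m + of_nat ?j = of_nat p * (of_nat k' / of_nat m :: rat)"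
  proof -
    have "of_nat k + of_nat ?j * of_nat m = (of_nat p * of_nat k' :: rat)"
      using k' by (metis of_nat_add of_nat_mult)
    then show ?thesis
      using k by (simp add: field_simps)
  qed
  have eq': "1 - of_nat k / of_nat m + of_nat (p - 1 - ?j) = of_nat p * (1 - of_nat k' / of_nat m :: rat)"
    using eq j by (simp add: of_nat_diff algebra_simps)
  have j': "p - 1 - ?j < p"
    using p0 by simp
  ultimately show ?thesis
    using pochhammer_quotient_prime_multiple [OF p j int int eq]
      pochhammer_quotient_prime_multiple [OF p j' diff [OF one int] diff [OF one int] eq']
    by (intro that [of k']) auto
qed

lemma hyp_seq_eq_pochhammer_quotient:
  "hyp_seq m n = pochhammer_quotient (of_nat 1 / of_nat m) n * pochhammer_quotient (1 - of_nat 1 / of_nat m) n"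
  by (simp add: hyp_seq_def pochhammer_quotient_def power2_eq_square)

text \<open>
  One application of Dwork's congruence reduces the value at \<open>p\<close> to \<open>k (m - k) / m\<^sup>2\<close>, two
  applications reduce the value at \<open>p\<^sup>2\<close> to \<open>l (m - l) / m\<^sup>2\<close>, where \<open>k\<close> and \<open>l\<close> are the residues
  of the inverses of \<open>p\<close> and \<open>p\<^sup>2\<close> modulo \<open>m\<close>.
\<close>

lemma hyp_seq_not_prime_square_cong:
  fixes m p :: nat
  assumes m: "m \<ge> 2" and p: "prime p" "m\<^sup>2 < p"
    and not1: "\<not> [int p = 1] (mod int m)" and not_m1: "\<not> [int p = -1] (mod int m)"
  shows "\<not> cong_in (p_integers p) p (hyp_seq m p) (hyp_seq m (p * p))"
proof
  assume cong: "cong_in (p_integers p) p (hyp_seq m p) (hyp_seq m (p * p))"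
  interpret subring_mod_prime "p_integers p" p
    by (rule subring_p_integers [OF p(1)])
  have mp: "m < p"
    using p(2) m by (meson le_less_trans power2_nat_le_imp_le order_refl self_le_power le_trans one_le_numeral zero_less_numeral)
  have pm: "\<not> p dvd m"
    using mp m by (auto dest: dvd_imp_le)
  have int: "of_nat l / of_nat m \<in> p_integers p" for l
    by (intro p_integers_divide_of_nat p of_nat pm)
  let ?f = "\<lambda>k. pochhammer_quotient (of_nat k / of_nat m)"
  let ?g = "\<lambda>k. pochhammer_quotient (1 - of_nat k / of_nat m)"
  have f1: "?f k 1 = of_nat k / of_nat m" "?g k 1 = 1 - of_nat k / of_nat m" for k
    by (simp_all add: pochhammer_quotient_def)
  have f1R: "?f k 1 \<in> p_integers p" "?g k 1 \<in> p_integers p" for k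
    unfolding f1 by (intro diff one int)+
  obtain k where k: "0 < k" "k < m" "[p * k = 1] (mod m)"
    and step1: "\<And>n. ?f k n \<in> p_integers p \<Longrightarrow>
      ?f 1 (p * n) \<in> p_integers p \<and> cong_in (p_integers p) p (?f 1 (p * n)) (?f k n)"
      "\<And>n. ?g k n \<in> p_integers p \<Longrightarrow>
      ?g 1 (p * n) \<in> p_integers p \<and> cong_in (p_integers p) p (?g 1 (p * n)) (?g k n)"
    using pochhammer_quotient_dwork_step [OF p(1) mp, of 1] m by auto
  obtain l where l: "0 < l" "l < m" "[p * l = k] (mod m)"
    and step2: "\<And>n. ?f l n \<in> p_integers p \<Longrightarrow>
      ?f k (p * n) \<in> p_integers p \<and> cong_in (p_integers p) p (?f k (p * n)) (?f l n)"
      "\<And>n. ?g l n \<in> p_integers p \<Longrightarrow>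
      ?g k (p * n) \<in> p_integers p \<and> cong_in (p_integers p) p (?g k (p * n)) (?g l n)"
    using pochhammer_quotient_dwork_step [OF p(1) mp k(1,2)] by auto
  have A1: "cong_in (p_integers p) p (hyp_seq m p) (?f k 1 * ?g k 1)"
    unfolding hyp_seq_eq_pochhammer_quotient
    using step1(1) [of 1] step1(2) [of 1] f1R [of k] by (intro cong_in_mult) auto
  have k2: "?f k p \<in> p_integers p" "?g k p \<in> p_integers p"
    "cong_in (p_integers p) p (?f k p) (?f l 1)" "cong_in (p_integers p) p (?g k p) (?g l 1)"
    using step2(1) [of 1] step2(2) [of 1] f1R [of l] by auto
  have "cong_in (p_integers p) p (hyp_seq m (p * p)) (?f k p * ?g k p)"
    unfolding hyp_seq_eq_pochhammer_quotient
    using step1(1) [of p] step1(2) [of p] k2 by (intro cong_in_mult) auto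
  also have "cong_in (p_integers p) p (?f k p * ?g k p) (?f l 1 * ?g l 1)"
    using k2 f1R by (intro cong_in_mult) auto
  finally have "cong_in (p_integers p) p (?f k 1 * ?g k 1) (?f l 1 * ?g l 1)"
    by (rule cong_in_trans [OF cong_in_trans [OF cong_in_sym [OF A1] cong]])
  then have "cong_in (p_integers p) p (of_nat (m ^ 2) * (?f k 1 * ?g k 1)) (of_nat (m ^ 2) * (?f l 1 * ?g l 1))"
    by (rule cong_in_mult [OF cong_in_refl _ of_nat mult [OF f1R]])
  moreover have "of_nat (m ^ 2) * (?f i 1 * ?g i 1) = of_int (int i * (int m - int i))" for i
    unfolding f1 using m by (simp add: field_simps power2_eq_square)
  ultimately have dvd: "int p dvd int k * (int m - int k) - int l * (int m - int l)"
    by (intro p_integers_cong_of_int [OF p(1)]) simp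
  have bound: "0 \<le> int i * (int m - int i) \<and> int i * (int m - int i) < int p" if "0 < i" "i < m" for i
  proof -
    have "int i * (int m - int i) \<le> int m * int m"
      using that by (intro mult_mono) auto
    also have "\<dots> < int p"
      using p(2) by (metis of_nat_less_iff of_nat_mult power2_eq_square)
    finally show ?thesis
      using that by simp
  qed
  have "int k * (int m - int k) = int l * (int m - int l)"
  proof -
    have "\<bar>int k * (int m - int k) - int l * (int m - int l)\<bar> < int p"
      using bound [OF k(1,2)] bound [OF l(1,2)] by linarith
    then show ?thesis
      using dvd zdvd_imp_le by (metis abs_of_nonneg dvd_abs_iff abs_ge_zero eq_iff_diff_eq_0 not_less zero_less_abs_iff)
  qed
  \<comment> \<open>The values \<open>k (m - k)\<close> determine \<open>k\<close> up to exchanging \<open>k\<close> and \<open>m - k\<close>.\<close>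
  then have "(int k - int l) * (int m - int k - int l) = 0"
    by (simp add: algebra_simps)
  then consider "l = k" | "int l = int m - int k"
    by auto
  moreover have pk: "[int p * int k = 1] (mod int m)" and pl: "[int p * int l = int k] (mod int m)"
    using k(3) l(3) cong_int_iff [of "p * k" 1 m] cong_int_iff [of "p * l" k m] by simp_all
  ultimately show False
  proof cases
    case 1
    then have "[int k = 1] (mod int m)"
      using pk pl cong_sym cong_trans by blast
    then have "[int p * int k = int p * 1] (mod int m)"
      by (intro cong_mult cong_refl)
    then show False
      using pk not1 by (metis cong_sym cong_trans mult.right_neutral)
  next
    case 2
    have "[int p * int l = int p * (- int k)] (mod int m)"
      by (simp add: 2 cong_iff_dvd_diff algebra_simps)
    also have "[int p * (- int k) = - 1] (mod int m)"
      using pk by (simp add: cong_minus_minus_iff)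
    finally have "[int k = - 1] (mod int m)"
      using pl cong_sym cong_trans by blast
    then have "[int p * int k = int p * (- 1)] (mod int m)"
      by (intro cong_mult cong_refl)
    then have "[int p * (- 1) = 1] (mod int m)"
      using pk cong_sym cong_trans by blast
    then show False
      using not_m1 cong_minus_minus_iff [of "int p" "- 1" "int m"] by simp
  qed
qed

section \<open>Large primes outside the classes of 1 and -1\<close>

text \<open>
  The witness is 2 for odd \<open>m\<close>, and an odd number just below \<open>m / 2\<close> for even \<open>m\<close>: \<open>m / 2 - 1\<close> if \<open>m\<close> is
  divisible by 4, and \<open>m / 2 - 2\<close> otherwise.  A common divisor with \<open>m\<close> is odd and divides 4.
\<close>

lemma ex_coprime_neq_pm1:
  fixes m :: nat
  assumes "m \<ge> 2" "m \<notin> {2, 3, 4, 6}"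
  obtains a where "coprime a m" "1 < a" "a + 1 < m"
proof -
  have "m = 5 \<or> m \<ge> 7"
    using assms by auto
  then consider "odd m" "m \<ge> 5" | k where "m = 4 * k" "k \<ge> 2" | k where "m = 4 * k + 2" "k \<ge> 2"
  proof (cases "odd m")
    case False
    then obtain l where l: "m = 2 * l"
      by auto
    show ?thesis
    proof (cases "even l")
      case True
      then obtain k where "l = 2 * k"
        by (elim evenE) auto
      then show ?thesis
        using l \<open>m = 5 \<or> m \<ge> 7\<close> by (intro that(2) [of k]; presburger)
    next
      case False
      then obtain k where "l = 2 * k + 1"
        by (elim oddE) auto
      then show ?thesis
        using l \<open>m = 5 \<or> m \<ge> 7\<close> by (intro that(3) [of k]; presburger)
    qed
  qed (use that(1) in auto)
  then show ?thesis
  proof cases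
    case 1
    then show ?thesis
      by (intro that [of 2]) (auto simp: coprime_left_2_iff_odd)
  next
    case (2 k)
    have "coprime (2 * k - 1) (4 * k)"
    proof (rule coprimeI)
      fix c assume c: "c dvd 2 * k - 1" "c dvd 4 * k"
      have "4 * k - 2 * (2 * k - 1) = 2"
        using 2 by simp
      then have "c dvd 2"
        using c by (metis dvd_diff_nat dvd_mult)
      moreover have "odd c"
        using c(1) 2 dvd_trans [of 2 c "2 * k - 1"] by auto
      then have "coprime c 2"
        by simp
      ultimately show "is_unit c"
        by (meson coprime_absorb_left)
    qed
    then show ?thesis
      using 2 by (intro that [of "2 * k - 1"]) auto
  next
    case (3 k)
    have "coprime (2 * k - 1) (4 * k + 2)"
    proof (rule coprimeI)
      fix c assume c: "c dvd 2 * k - 1" "c dvd 4 * k + 2"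
      have "4 * k + 2 - 2 * (2 * k - 1) = 2 ^ 2"
        using 3 by simp
      then have "c dvd 2 ^ 2"
        using c by (metis dvd_diff_nat dvd_mult)
      moreover have "odd c"
        using c(1) 3 dvd_trans [of 2 c "2 * k - 1"] by auto
      then have "coprime c (2 ^ 2)"
        unfolding coprime_power_right_iff by simp
      ultimately show "is_unit c"
        by (meson coprime_absorb_left)
    qed
    then show ?thesis
      using 3 by (intro that [of "2 * k - 1"]) auto
  qed
qed

text \<open>
  Every prime up to \<open>B\<close> divides exactly one of the two summands of \<open>m \<Prod>S + a\<close>, where \<open>S\<close> is the set
  of the primes up to \<open>B\<close> that do not divide \<open>a\<close>; hence it does not divide the sum.
\<close>

lemma ex_large_prime_factor_free:
  fixes a m B :: nat
  assumes "coprime a m" "0 < a" "0 < m"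
  obtains N where "0 < N" "[N = a] (mod m)" "\<And>q. prime q \<Longrightarrow> q dvd N \<Longrightarrow> B < q"
proof
  let ?S = "{q. prime q \<and> q \<le> B \<and> \<not> q dvd a}"
  have fin: "finite ?S"
    by (rule finite_subset [of _ "{..B}"]) auto
  let ?N = "m * \<Prod>?S + a"
  show "0 < ?N"
    using assms by simp
  show "[?N = a] (mod m)"
    by (simp add: cong_def)
  fix q assume q: "prime q" "q dvd ?N"
  show "B < q"
  proof (rule ccontr)
    assume "\<not> B < q"
    show False
    proof (cases "q dvd a")
      case False
      then have "q dvd \<Prod>?S"
        using q \<open>\<not> B < q\<close> fin by (intro dvd_prodI [of ?S q id, simplified]) auto
      then show False
        using q(2) False by (metis dvd_add_right_iff dvd_mult)
    next
      case True
      then have "q dvd m * \<Prod>?S"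
        using q(2) by (simp add: dvd_add_left_iff)
      then have "q dvd m \<or> (\<exists>r\<in>?S. q dvd r)"
        using q(1) fin by (auto simp: prime_dvd_mult_iff prime_dvd_prod_iff)
      then show False
      proof
        assume "q dvd m"
        then show False
          using True assms(1) q(1) by (metis coprime_common_divisor not_prime_unit)
      next
        assume "\<exists>r\<in>?S. q dvd r"
        then obtain r where "prime r" "\<not> r dvd a" "q dvd r"
          by blast
        then show False
          using True q(1) primes_dvd_imp_eq [of q r] by simp
      qed
    qed
  qed
qed

text \<open>
  The classes of 1 and -1 are closed under multiplication, so a number outside of them has a prime
  factor outside of them.
\<close>

lemma ex_large_prime_not_cong_pm1:
  fixes m B :: nat
  assumes "m \<ge> 2" "m \<notin> {2, 3, 4, 6}"
  obtains p where "prime p" "B < p" "\<not> [int p = 1] (mod int m)" "\<not> [int p = -1] (mod int m)"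
proof -
  obtain a where a: "coprime a m" "1 < a" "a + 1 < m"
    using assms by (rule ex_coprime_neq_pm1)
  then obtain N where N: "0 < N" "[N = a] (mod m)" "\<And>q. prime q \<Longrightarrow> q dvd N \<Longrightarrow> B < q"
    using ex_large_prime_factor_free [of a m B] by auto
  have "\<exists>p. prime p \<and> p dvd N \<and> \<not> [int p = 1] (mod int m) \<and> \<not> [int p = -1] (mod int m)"
  proof (rule ccontr)
    assume contr: "\<not> ?thesis"
    have "[int n = 1] (mod int m) \<or> [int n = -1] (mod int m)" if "n dvd N" for n
      using that
    proof (induction n rule: prime_divisors_induct)
      case zero
      then show ?case
        using N(1) by simp
    next
      case (unit n)
      then show ?case by simp
    next
      case (factor p n)
      then have "[int n = 1] (mod int m) \<or> [int n = -1] (mod int m)"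
        using dvd_mult_right by blast
      moreover have "[int p = 1] (mod int m) \<or> [int p = -1] (mod int m)"
        using factor contr dvd_mult_left by blast
      ultimately show ?case
        using cong_mult [of "int p" _ "int m" "int n"] by fastforce
    qed
    from this [of N] have "[int N = 1] (mod int m) \<or> [int N = -1] (mod int m)"
      by simp
    moreover have "[int N = int a] (mod int m)"
      using N(2) by (simp add: cong_int_iff)
    ultimately have "[int a = 1] (mod int m) \<or> [int a = -1] (mod int m)"
      by (meson cong_sym cong_trans)
    then have "int m dvd int a - 1 \<or> int m dvd int a + 1"
      by (simp add: cong_iff_dvd_diff)
    then show False
      using a zdvd_imp_le [of "int m" "int a - 1"] zdvd_imp_le [of "int m" "int a + 1"] by auto
  qed
  then show ?thesis
    using that N(3) by blast
qed

section \<open>Products of binomial coefficients\<close>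

lemma in_vars_add: "in_vars d p \<Longrightarrow> in_vars d q \<Longrightarrow> in_vars d (p + q)"
  unfolding in_vars_iff_lookup lookup_add by (metis add.right_neutral)

lemma in_vars_mult:
  fixes P Q :: laurent_rat
  assumes "in_vars d P" "in_vars d Q"
  shows "in_vars d (P * Q)"
  unfolding in_vars_def
proof
  fix e assume "e \<in> Poly_Mapping.keys (P * Q)"
  then obtain a b where "e = a + b" "a \<in> Poly_Mapping.keys P" "b \<in> Poly_Mapping.keys Q"
    using keys_mult [of P Q] by blast
  then show "Poly_Mapping.keys e \<subseteq> {..<d}"
    using assms Poly_Mapping.keys_add [of a b] unfolding in_vars_def by blast
qed

lemma in_vars_one: "in_vars d (1 :: laurent_rat)"
  by (simp add: in_vars_def)

lemma in_vars_power:
  fixes P :: laurent_rat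
  shows "in_vars d P \<Longrightarrow> in_vars d (P ^ n)"
  by (induction n) (auto intro: in_vars_mult in_vars_one)

text \<open>
  The coefficient of \<open>x\<close> to the power \<open>b n\<close> in \<open>(1 + x)\<close> to the power \<open>a n\<close> is the constant term of the
  \<open>n\<close>-th power of a fixed Laurent polynomial.  Two such factors in separate variables multiply.
\<close>

lemma is_constant_term_binomial_product:
  "is_constant_term (\<lambda>n. of_nat ((a * n) choose (b * n)) * of_nat ((c * n) choose (d * n)) * K ^ n)"
proof -
  define X :: "nat \<Rightarrow> laurent_rat" where "X v = Poly_Mapping.single (Poly_Mapping.single v 1) 1" for v
  define s :: "nat \<Rightarrow>\<^sub>0 int" where
    "s = Poly_Mapping.single 0 (- int b) + Poly_Mapping.single 1 (- int d)"
  define P where "P = (X 0 + 1) ^ a * (X 1 + 1) ^ c * Poly_Mapping.single s K"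
  have Xpow: "X v ^ k = Poly_Mapping.single (Poly_Mapping.single v (int k)) 1" for v k
  proof -
    have "(\<Sum>i<k. Poly_Mapping.single v 1) = Poly_Mapping.single v (int k)"
      by (rule poly_mapping_eqI) (simp add: lookup_sum_const lookup_single when_def del: sum_constant)
    then show ?thesis
      by (simp add: X_def single_power del: sum_constant)
  qed
  have binom: "(X v + 1) ^ N = (\<Sum>k\<le>N. Poly_Mapping.single (Poly_Mapping.single v (int k)) (of_nat (N choose k)))"
    for v N
    unfolding binomial_ring Xpow
    by (intro sum.cong) (simp_all add: mult_single single_of_nat [symmetric] del: single_of_nat)
  have vars: "in_vars 2 P"
  proof -
    have "in_vars 2 (X v)" if "v < 2" for v
      unfolding X_def using that by (intro in_vars_single) simp
    moreover have "Poly_Mapping.keys s \<subseteq> {..<2}"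
      unfolding s_def by (rule order_trans [OF Poly_Mapping.keys_add]) auto
    ultimately show ?thesis
      unfolding P_def
      by (intro in_vars_mult in_vars_power in_vars_add in_vars_one in_vars_single) auto
  qed
  have "ct (P ^ n * 1) = of_nat ((a * n) choose (b * n)) * of_nat ((c * n) choose (d * n)) * K ^ n" for n
  proof -
    let ?s = "\<Sum>i<n. s"
    let ?e = "\<lambda>k l. Poly_Mapping.single 0 (int k) + Poly_Mapping.single 1 (int l) + ?s :: nat \<Rightarrow>\<^sub>0 int"
    have lookup_e: "Poly_Mapping.lookup (?e k l) v =
        (if v = 0 then int k - int (b * n) else if v = 1 then int l - int (d * n) else 0)" for k l v
      by (auto simp: lookup_add lookup_sum_const lookup_single when_def s_def algebra_simps
          simp del: sum_constant single_of_nat)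
    have e0: "?e k l = 0 \<longleftrightarrow> k = b * n \<and> l = d * n" for k l
    proof
      assume "?e k l = 0"
      then have "Poly_Mapping.lookup (?e k l) v = 0" for v
        by (simp only: lookup_zero)
      from this [of 0] this [of 1] show "k = b * n \<and> l = d * n"
        unfolding lookup_e by (simp del: of_nat_mult)
    next
      assume "k = b * n \<and> l = d * n"
      then have "Poly_Mapping.lookup (?e k l) v = Poly_Mapping.lookup 0 v" for v
        unfolding lookup_e by simp
      then show "?e k l = 0"
        by (rule poly_mapping_eqI)
    qed
    have "P ^ n = (X 0 + 1) ^ (a * n) * (X 1 + 1) ^ (c * n) * Poly_Mapping.single ?s (K ^ n)"
      by (simp add: P_def power_mult_distrib power_mult single_power del: sum_constant)
    also have "\<dots> = (\<Sum>k\<le>a * n. \<Sum>l\<le>c * n. Poly_Mapping.single (?e k l)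
        (of_nat ((a * n) choose k) * of_nat ((c * n) choose l) * K ^ n))"
      unfolding binom sum_product by (simp only: sum_distrib_right mult_single)
    finally have Pn: "P ^ n = \<dots>" .
    have "ct (P ^ n * 1) = (\<Sum>k\<le>a * n. \<Sum>l\<le>c * n. if k = b * n \<and> l = d * n
        then of_nat ((a * n) choose k) * of_nat ((c * n) choose l) * K ^ n else 0)"
      unfolding Pn ct_def mult_1_right lookup_sum lookup_single when_def e0 ..
    also have "\<dots> = (\<Sum>k\<le>a * n. \<Sum>l\<le>c * n. if l = d * n then if k = b * n
        then of_nat ((a * n) choose (b * n)) * of_nat ((c * n) choose (d * n)) * K ^ n else 0 else 0)"
      by (intro sum.cong) auto
    also have "(\<Sum>k\<le>M. \<Sum>l\<le>N. if l = j then if k = i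
        then of_nat (M choose i) * of_nat (N choose j) * x else 0 else 0) =
        of_nat (M choose i) * of_nat (N choose j) * x" for M N i j and x :: rat
      by (cases "i \<le> M"; cases "j \<le> N") (simp_all add: binomial_eq_0)
    finally show ?thesis .
  qed
  then show ?thesis
    unfolding is_constant_term_def
    by (intro exI [of _ 2] exI [of _ P] exI [of _ 1]) (use vars in_vars_one in auto)
qed

lemma fact_mult_Suc:
  "fact (2 * Suc n) = (fact (2 * n) * ((2 * of_nat n + 1) * (2 * of_nat n + 2)) :: rat)" (is ?t2)
  "fact (3 * Suc n) = (fact (3 * n) * ((3 * of_nat n + 1) * (3 * of_nat n + 2) * (3 * of_nat n + 3)) :: rat)" (is ?t3)
  "fact (4 * Suc n) = (fact (4 * n) * ((4 * of_nat n + 1) * (4 * of_nat n + 2) * (4 * of_nat n + 3) *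
     (4 * of_nat n + 4)) :: rat)" (is ?t4)
  "fact (6 * Suc n) = (fact (6 * n) * ((6 * of_nat n + 1) * (6 * of_nat n + 2) * (6 * of_nat n + 3) *
     (6 * of_nat n + 4) * (6 * of_nat n + 5) * (6 * of_nat n + 6)) :: rat)" (is ?t6)
proof -
  have *: "2 * Suc n = Suc (Suc (2 * n))" "3 * Suc n = Suc (Suc (Suc (3 * n)))"
    "4 * Suc n = Suc (Suc (Suc (Suc (4 * n))))"
    "6 * Suc n = Suc (Suc (Suc (Suc (Suc (Suc (6 * n))))))"
    by simp_all
  show ?t2 ?t3 ?t4 ?t6
    unfolding * fact_Suc by (simp_all add: mult_ac add_ac)
qed

text \<open>
  For \<open>m = 2, 3, 4, 6\<close> the fractions \<open>1/m\<close> and \<open>1 - 1/m\<close> are all the reduced fractions with denominator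
  \<open>m\<close> between 0 and 1, and the product of the two rising factorials is therefore a quotient of
  factorials of multiples of \<open>n\<close>.  In each case both sides acquire the same factor from \<open>n\<close> to
  \<open>n + 1\<close>.
\<close>

lemma hyp_seq_2:
  "hyp_seq 2 n = of_nat ((2 * n) choose (1 * n)) * of_nat ((2 * n) choose (1 * n)) * (1 / 16) ^ n"
proof -
  have "pochhammer (1 / 2) n * pochhammer (1 / 2) n * 16 ^ n * fact n ^ 2 = (fact (2 * n) ^ 2 :: rat)"
  proof (induction n)
    case (Suc n)
    have "pochhammer (1 / 2) (Suc n) * pochhammer (1 / 2) (Suc n) * 16 ^ (Suc n) * fact (Suc n) ^ 2 =
        (pochhammer (1 / 2) n * pochhammer (1 / 2) n * 16 ^ n * fact n ^ 2 * (((2 * of_nat n + 1) * (2 * of_nat n + 2)) ^ 2) :: rat)"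
      unfolding fact_mult_Suc by (simp add: pochhammer_rec' field_simps power2_eq_square)
    also have "\<dots> = fact (2 * (Suc n)) ^ 2"
      unfolding Suc.IH fact_mult_Suc by (simp add: field_simps power2_eq_square)
    finally show ?case .
  qed simp
  then show ?thesis
    by (simp add: hyp_seq_def binomial_fact field_simps power2_eq_square)
qed

lemma hyp_seq_3:
  "hyp_seq 3 n = of_nat ((3 * n) choose (1 * n)) * of_nat ((2 * n) choose (1 * n)) * (1 / 27) ^ n"
proof -
  have "pochhammer (1 / 3) n * pochhammer (2 / 3) n * 27 ^ n * fact n = (fact (3 * n) :: rat)"
  proof (induction n)
    case (Suc n)
    have "pochhammer (1 / 3) (Suc n) * pochhammer (2 / 3) (Suc n) * 27 ^ (Suc n) * fact (Suc n) =
        (pochhammer (1 / 3) n * pochhammer (2 / 3) n * 27 ^ n * fact n * ((3 * of_nat n + 1) * (3 * of_nat n + 2) * (3 * of_nat n + 3)) :: rat)"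
      unfolding fact_mult_Suc by (simp add: pochhammer_rec' field_simps power2_eq_square)
    also have "\<dots> = fact (3 * (Suc n))"
      unfolding Suc.IH fact_mult_Suc by (simp add: field_simps power2_eq_square)
    finally show ?case .
  qed simp
  then show ?thesis
    by (simp add: hyp_seq_def binomial_fact field_simps power2_eq_square)
qed

lemma hyp_seq_4:
  "hyp_seq 4 n = of_nat ((4 * n) choose (2 * n)) * of_nat ((2 * n) choose (1 * n)) * (1 / 64) ^ n"
proof -
  have "pochhammer (1 / 4) n * pochhammer (3 / 4) n * 64 ^ n * fact (2 * n) = (fact (4 * n) :: rat)"
  proof (induction n)
    case (Suc n)
    have "pochhammer (1 / 4) (Suc n) * pochhammer (3 / 4) (Suc n) * 64 ^ (Suc n) * fact (2 * (Suc n)) =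
        (pochhammer (1 / 4) n * pochhammer (3 / 4) n * 64 ^ n * fact (2 * n) * ((4 * of_nat n + 1) * (4 * of_nat n + 2) * (4 * of_nat n + 3) * (4 * of_nat n + 4)) :: rat)"
      unfolding fact_mult_Suc by (simp add: pochhammer_rec' field_simps power2_eq_square)
    also have "\<dots> = fact (4 * (Suc n))"
      unfolding Suc.IH fact_mult_Suc by (simp add: field_simps power2_eq_square)
    finally show ?case .
  qed simp
  then show ?thesis
    by (simp add: hyp_seq_def binomial_fact field_simps power2_eq_square)
qed

lemma hyp_seq_6:
  "hyp_seq 6 n = of_nat ((6 * n) choose (3 * n)) * of_nat ((3 * n) choose (1 * n)) * (1 / 432) ^ n"
proof -
  have "pochhammer (1 / 6) n * pochhammer (5 / 6) n * 432 ^ n * fact (3 * n) * fact (2 * n) = (fact (6 * n) * fact n :: rat)"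
  proof (induction n)
    case (Suc n)
    have "pochhammer (1 / 6) (Suc n) * pochhammer (5 / 6) (Suc n) * 432 ^ (Suc n) * fact (3 * (Suc n)) * fact (2 * (Suc n)) =
        (pochhammer (1 / 6) n * pochhammer (5 / 6) n * 432 ^ n * fact (3 * n) * fact (2 * n) * ((6 * of_nat n + 1) * (6 * of_nat n + 2) * (6 * of_nat n + 3) * (6 * of_nat n + 4) * (6 * of_nat n + 5) * (6 * of_nat n + 6) * (of_nat n + 1)) :: rat)"
      unfolding fact_mult_Suc by (simp add: pochhammer_rec' field_simps power2_eq_square)
    also have "\<dots> = fact (6 * (Suc n)) * fact (Suc n)"
      unfolding Suc.IH fact_mult_Suc by (simp add: field_simps power2_eq_square)
    finally show ?case .
  qed simp
  then show ?thesis
    by (simp add: hyp_seq_def binomial_fact field_simps power2_eq_square)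
qed

lemma is_constant_term_hyp_seq:
  assumes "m \<in> {2, 3, 4, 6}"
  shows "is_constant_term (hyp_seq m)"
  using assms is_constant_term_binomial_product [of 2 1 2 1 "1 / 16"]
    is_constant_term_binomial_product [of 3 1 2 1 "1 / 27"]
    is_constant_term_binomial_product [of 4 2 2 1 "1 / 64"]
    is_constant_term_binomial_product [of 6 3 3 1 "1 / 432"]
  unfolding hyp_seq_2 [symmetric] hyp_seq_3 [symmetric] hyp_seq_4 [symmetric] hyp_seq_6 [symmetric]
  by auto

section \<open>Classification\<close>

theorem lemma6p4:
  fixes m :: nat
  assumes "m \<ge> 2"
  shows "is_diagonal (hyp_seq m) \<and> (is_constant_term (hyp_seq m) \<longleftrightarrow> m \<in> {2, 3, 4, 6})"
proof (intro conjI iffI)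
  show "is_diagonal (hyp_seq m)"
    using assms by (rule is_diagonal_hyp_seq)
  show "is_constant_term (hyp_seq m)" if "m \<in> {2, 3, 4, 6}"
    using that by (rule is_constant_term_hyp_seq)
  show "m \<in> {2, 3, 4, 6}" if ct: "is_constant_term (hyp_seq m)"
  proof (rule ccontr)
    assume m: "m \<notin> {2, 3, 4, 6}"
    obtain B where B: "\<And>p. p \<ge> B \<Longrightarrow> prime p \<Longrightarrow>
        cong_in (p_integers p) p (hyp_seq m p) (hyp_seq m (p * p))"
      using constant_term_prime_square_cong [OF ct] unfolding eventually_sequentially by blast
    obtain p where "prime p" "max B (m\<^sup>2) < p"
      "\<not> [int p = 1] (mod int m)" "\<not> [int p = -1] (mod int m)"
      using ex_large_prime_not_cong_pm1 [OF assms m] .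
    then show False
      using B [of p] hyp_seq_not_prime_square_cong [OF assms, of p] by simp
  qed
qed

end
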